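(* Let $f,g\in\mathcal{O}_2=\mathbb{C}\{x,y\}$ be relatively prime, both vanishing at the origin, such that the foliation $\mathcal{F}_{\omega_{f/g}}$ defined by $\omega_{f/g}=g\,df-f\,dg$ has an isolated singularity at $0\in\mathbb{C}^2$. Let $\mathcal{B}=\mathcal{B}_0-\mathcal{B}_\infty$ be a balanced divisor of separatrices for $\mathcal{F}_{\omega_{f/g}}$, where $\mathcal{B}_0:fgh_1\cdots h_r=0$ and $\mathcal{B}_\infty:\varphi_1\cdots\varphi_r=0$. Then $$\tau(f,g)=\tau(fg)+\sum_{j=1}^r(\tau(h_j)-\tau_{gen})+r^2\,I_0(f,g)+\Theta_{\mathcal{B}_0}+\Theta_{h_1\cdots h_r}-\Theta_{\mathcal{B}_\infty}.$$
   Context: $I_0(f,g)=\dim_{\mathbb{C}}\mathcal{O}_2/(f,g)$. For a reduced curve germ $C:h=0$, $\mu(C)=\dim_{\mathbb{C}}\mathcal{O}_2/(h_x,h_y)$ and $\tau(C)=\tau(h)=\dim_{\mathbb{C}}\mathcal{O}_2/(h,h_x,h_y)$. Under the isolated singularity assumption all members $C_{[\alpha:\beta]}:\alpha f+\beta g=0$ of the pencil are reduced, and they are $\mathcal{F}_{\omega_{f/g}}$-invariant. Let $\mu_{gen}$ and $\tau_{gen}$ be the minima over $[\alpha:\beta]\in\mathbb{P}^1$ of $\mu(C_{[\alpha:\beta]})$ and $\tau(C_{[\alpha:\beta]})$; each is attained for all but finitely many $[\alpha:\beta]$. The bifurcation fibers are the members with $\mu(C_{[\alpha:\beta]})>\mu_{gen}$;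 a generic fiber is a member with $\mu=\mu_{gen}$ and $\tau=\tau_{gen}$. Primitive balanced divisors of separatrices of $\mathcal{F}_{\omega_{f/g}}$ (adapted to $fg=0$) are the divisors $\mathcal{B}=\mathcal{B}_0-\mathcal{B}_\infty=(f)+(g)+(h_1)+\cdots+(h_r)-(\varphi_1)-\cdots-(\varphi_r)$, where $h_1,\dots,h_r$ are the bifurcation fibers other than $f=0$ and $g=0$, and $\varphi_1,\dots,\varphi_r$ are pairwise distinct generic fibers different from $f=0$ and $g=0$. Empty products are $1$. For a reduced invariant curve $h=0$, $\tau(\mathcal{F}_{\omega_{f/g}},h):=\dim_{\mathbb{C}}\mathcal{O}_2/(gf_x-fg_x,\,gf_y-fg_y,\,h)$. The Tjurina number of the pair is $$\tau(f,g):=\tau(\mathcal{F}_{\omega_{f/g}},\mathcal{B}):=\tau(\mathcal{F}_{\omega_{f/g}},\mathcal{B}_0)-\tau(\mathcal{F}_{\omega_{f/g}},\mathcal{B}_\infty)+I_0(\mathcal{B}_0,\mathcal{B}_\infty),$$ where $\mathcal{B}$ is a primitive balanced divisor of separatrices (here the given $\mathcal{B}$). For pairwise coprime reduced $f_1,\dots,f_k$, the number $\Theta$ attached to the factorization $f_1\cdots f_k$ is determined by $\tau(f_1\cdots f_k)=\sum_{j}\tau(f_j)+\sum_{i<j}I_0(f_i,f_j)+\Theta_{f_1\cdots f_k}$. $\Theta_{h_1\cdots h_r}$ and $\Theta_{\mathcal{B}_\infty}=\Theta_{\varphi_1\cdots\varphi_r}$ are taken with respect to the $r$ displayed factors, while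 $\Theta_{\mathcal{B}_0}$ is taken with respect to the two factors $fg$ and $h_1\cdots h_r$, i.e. $\tau(fgh_1\cdots h_r)=\tau(fg)+\tau(h_1\cdots h_r)+I_0(fg,h_1\cdots h_r)+\Theta_{\mathcal{B}_0}$. For $r=0$, $\Theta=0$. *)

theory Defs
  imports
    "HOL-Analysis.Analysis"
    "HOL-Computational_Algebra.Formal_Power_Series"
    "HOL-Algebra.Embedded_Algebras"
    "HOL-Algebra.QuotRing"
    "HOL-Algebra.Algebraic_Closure_Type"
begin

section \<open>The ring of convergent power series in two variables\<close>

text \<open>A formal power series in \<open>x\<close>, \<open>y\<close> is represented as a series in \<open>y\<close> whose coefficients are
  series in \<open>x\<close>: the coefficient of \<open>x^i y^j\<close> in \<open>F\<close> is \<open>fps_nth (fps_nth F j) i\<close>.\<close>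

definition convergent_fps2 :: "complex fps fps \<Rightarrow> bool" where
  "convergent_fps2 F \<longleftrightarrow>
     (\<exists>\<rho>>0. (\<lambda>(i, j). norm (fps_nth (fps_nth F j) i) * \<rho> ^ (i + j)) summable_on (UNIV :: (nat \<times> nat) set))"

lemma convergent_fps2_iff_bound:
  "convergent_fps2 F \<longleftrightarrow> (\<exists>C>0. \<exists>R>0. \<forall>i j. norm (fps_nth (fps_nth F j) i) \<le> C * R ^ (i + j))"
proof
  assume "convergent_fps2 F"
  then obtain \<rho> where \<rho>: "\<rho> > 0"
    "(\<lambda>(i, j). norm (fps_nth (fps_nth F j) i) * \<rho> ^ (i + j)) summable_on (UNIV :: (nat \<times> nat) set)"
    unfolding convergent_fps2_def by blast
  define S where "S = infsum (\<lambda>(i, j). norm (fps_nth (fps_nth F j) i) * \<rho> ^ (i + j)) (UNIV :: (nat \<times> nat) set)"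
  have le: "norm (fps_nth (fps_nth F j) i) * \<rho> ^ (i + j) \<le> S" for i j
  proof -
    have "sum (\<lambda>(i, j). norm (fps_nth (fps_nth F j) i) * \<rho> ^ (i + j)) {(i, j)} \<le> S"
      unfolding S_def using \<rho> by (intro finite_sum_le_infsum) auto
    thus ?thesis by simp
  qed
  have "norm (fps_nth (fps_nth F j) i) \<le> (\<bar>S\<bar> + 1) * (1 / \<rho>) ^ (i + j)" for i j
  proof -
    have "norm (fps_nth (fps_nth F j) i) * \<rho> ^ (i + j) \<le> \<bar>S\<bar> + 1"
      using le[where i = i and j = j] by linarith
    thus ?thesis using \<rho>(1) by (simp add: field_simps power_divide)
  qed
  moreover have "\<bar>S\<bar> + 1 > 0" "1 / \<rho> > 0" using \<rho>(1) by auto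
  ultimately show "\<exists>C>0. \<exists>R>0. \<forall>i j. norm (fps_nth (fps_nth F j) i) \<le> C * R ^ (i + j)" by blast
next
  assume "\<exists>C>0. \<exists>R>0. \<forall>i j. norm (fps_nth (fps_nth F j) i) \<le> C * R ^ (i + j)"
  then obtain C R where CR: "C > 0" "R > 0"
    "\<And>i j. norm (fps_nth (fps_nth F j) i) \<le> C * R ^ (i + j)" by blast
  define \<rho> where "\<rho> = 1 / (2 * R)"
  have \<rho>: "\<rho> > 0" using CR by (simp add: \<rho>_def)
  have geo: "((\<lambda>i. (1/2) ^ i :: real) has_sum 2) UNIV"
    using norm_summable_imp_has_sum[OF _ geometric_sums[of "1/2 :: real"]]
      summable_geometric[of "1/2 :: real"] by simp
  have geo2: "(\<lambda>(i, j). (1/2) ^ i * (1/2) ^ j :: real) summable_on (UNIV \<times> UNIV)"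
  proof (rule summable_on_SigmaI[where g = "\<lambda>i. (1/2) ^ i * 2"])
    show "((\<lambda>j. case (i, j) of (i, j) \<Rightarrow> (1/2 :: real) ^ i * (1/2) ^ j) has_sum ((1/2) ^ i * 2)) UNIV" for i :: nat
      using has_sum_cmult_right[OF geo] by simp
    show "(\<lambda>i. (1/2) ^ i * 2 :: real) summable_on UNIV"
      by (intro summable_on_cmult_left has_sum_imp_summable[OF geo])
  qed auto
  have "(\<lambda>(i, j). C * ((1/2) ^ i * (1/2) ^ j)) summable_on (UNIV :: (nat \<times> nat) set)"
    using summable_on_cmult_right[OF geo2, of C] by (simp add: case_prod_unfold)
  hence "(\<lambda>(i, j). norm (fps_nth (fps_nth F j) i) * \<rho> ^ (i + j)) summable_on (UNIV :: (nat \<times> nat) set)"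
  proof (rule summable_on_comparison_test, safe)
    fix i j :: nat
    have "norm (fps_nth (fps_nth F j) i) * \<rho> ^ (i + j) \<le> (C * R ^ (i + j)) * \<rho> ^ (i + j)"
      using CR(3) \<rho> by (intro mult_right_mono) auto
    also have "\<dots> = C * (R * \<rho>) ^ (i + j)" by (simp add: power_mult_distrib)
    also have "R * \<rho> = 1/2" using CR(2) by (simp add: \<rho>_def)
    finally show "norm (fps_nth (fps_nth F j) i) * \<rho> ^ (i + j) \<le> C * ((1/2) ^ i * (1/2) ^ j)"
      by (simp add: power_add)
  qed (use \<rho> in auto)
  thus "convergent_fps2 F" unfolding convergent_fps2_def using \<rho> by blast
qed

lemma convergent_fps2_zero: "convergent_fps2 0"
  unfolding convergent_fps2_iff_bound by (intro exI[of _ 1] conjI) auto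

lemma convergent_fps2_finite:
  assumes "finite {(i, j). fps_nth (fps_nth F j) i \<noteq> 0}"
  shows "convergent_fps2 F"
proof -
  have "(\<lambda>(i, j). norm (fps_nth (fps_nth F j) i) * 1 ^ (i + j)) summable_on (UNIV :: (nat \<times> nat) set)"
    by (rule summable_on_cong_neutral[THEN iffD1, OF _ _ _ summable_on_finite[OF assms]]) auto
  thus ?thesis unfolding convergent_fps2_def by (intro exI[of _ 1]) auto
qed

lemma convergent_fps2_const: "convergent_fps2 (fps_const (fps_const c))"
  by (rule convergent_fps2_finite, rule finite_subset[of _ "{(0, 0)}"]) (auto split: if_splits)

lemma convergent_fps2_uminus: "convergent_fps2 F \<Longrightarrow> convergent_fps2 (- F)"
  unfolding convergent_fps2_def by simp

lemma convergent_fps2_add: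
  assumes "convergent_fps2 F" "convergent_fps2 G"
  shows "convergent_fps2 (F + G)"
proof -
  obtain C R where CR: "C > 0" "R > 0" "\<And>i j. norm (fps_nth (fps_nth F j) i) \<le> C * R ^ (i + j)"
    using assms(1) unfolding convergent_fps2_iff_bound by blast
  obtain D S where DS: "D > 0" "S > 0" "\<And>i j. norm (fps_nth (fps_nth G j) i) \<le> D * S ^ (i + j)"
    using assms(2) unfolding convergent_fps2_iff_bound by blast
  have "norm (fps_nth (fps_nth (F + G) j) i) \<le> (C + D) * (max R S) ^ (i + j)" for i j
  proof -
    have "norm (fps_nth (fps_nth (F + G) j) i) \<le> C * R ^ (i + j) + D * S ^ (i + j)"
      using CR(3)[of j i] DS(3)[of j i] norm_triangle_le add_mono by (simp add: norm_triangle_mono)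
    also have "\<dots> \<le> C * (max R S) ^ (i + j) + D * (max R S) ^ (i + j)"
      using CR DS by (intro add_mono mult_left_mono power_mono) auto
    finally show ?thesis by (simp add: algebra_simps)
  qed
  moreover have "C + D > 0" "max R S > 0" using CR DS by auto
  ultimately show ?thesis unfolding convergent_fps2_iff_bound by blast
qed

lemma convergent_fps2_mult:
  assumes "convergent_fps2 F" "convergent_fps2 G"
  shows "convergent_fps2 (F * G)"
proof -
  obtain C R where CR: "C > 0" "R > 0" "\<And>i j. norm (fps_nth (fps_nth F j) i) \<le> C * R ^ (i + j)"
    using assms(1) unfolding convergent_fps2_iff_bound by blast
  obtain D S where DS: "D > 0" "S > 0" "\<And>i j. norm (fps_nth (fps_nth G j) i) \<le> D * S ^ (i + j)"
    using assms(2) unfolding convergent_fps2_iff_bound by blast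
  define M where "M = max R S"
  have M: "M > 0" "R \<le> M" "S \<le> M" using CR by (auto simp: M_def)
  have "norm (fps_nth (fps_nth (F * G) j) i) \<le> (C * D) * (2 * M) ^ (i + j)" for i j
  proof -
    have "fps_nth (fps_nth (F * G) j) i =
       (\<Sum>l=0..j. \<Sum>k=0..i. fps_nth (fps_nth F l) k * fps_nth (fps_nth G (j - l)) (i - k))"
      by (simp add: fps_mult_nth fps_sum_nth)
    also have "norm \<dots> \<le> (\<Sum>l=0..j. \<Sum>k=0..i. (C * D) * M ^ (i + j))"
    proof (intro sum_norm_le)
      fix l k assume lk: "l \<in> {0..j}" "k \<in> {0..i}"
      have a: "norm (fps_nth (fps_nth F l) k) \<le> C * M ^ (k + l)"
        using CR(3)[of l k] power_mono[OF M(2), of "k + l"] CR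
        by (meson less_imp_le mult_left_mono order_trans)
      have b: "norm (fps_nth (fps_nth G (j - l)) (i - k)) \<le> D * M ^ (i - k + (j - l))"
        using DS(3)[of "j - l" "i - k"] power_mono[OF M(3), of "i - k + (j - l)"] DS
        by (meson less_imp_le mult_left_mono order_trans)
      have "norm (fps_nth (fps_nth F l) k * fps_nth (fps_nth G (j - l)) (i - k))
            \<le> (C * M ^ (k + l)) * (D * M ^ (i - k + (j - l)))"
        unfolding norm_mult using CR M by (intro mult_mono a b) auto
      also have "\<dots> = (C * D) * M ^ (k + l + (i - k + (j - l)))"
        by (simp add: power_add)
      also have "k + l + (i - k + (j - l)) = i + j" using lk by auto
      finally show "norm (fps_nth (fps_nth F l) k * fps_nth (fps_nth G (j - l)) (i - k))
            \<le> (C * D) * M ^ (i + j)" .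
    qed
    also have "\<dots> = real ((j + 1) * (i + 1)) * ((C * D) * M ^ (i + j))" by (simp add: algebra_simps)
    also have "\<dots> \<le> 2 ^ (i + j) * ((C * D) * M ^ (i + j))"
    proof (rule mult_right_mono)
      have "(j + 1) * (i + 1) \<le> 2 ^ j * 2 ^ i"
        by (intro mult_mono) (auto simp: Suc_le_eq less_exp)
      hence "real ((j + 1) * (i + 1)) \<le> real (2 ^ j * 2 ^ i)" by (rule of_nat_mono)
      thus "real ((j + 1) * (i + 1)) \<le> 2 ^ (i + j)" by (simp add: power_add mult.commute)
    qed (use CR DS M in auto)
    finally show ?thesis by (simp add: power_mult_distrib mult_ac)
  qed
  moreover have "C * D > 0" "2 * M > 0" using CR DS M by auto
  ultimately show ?thesis unfolding convergent_fps2_iff_bound by blast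
qed

lemma convergent_fps2_dy:
  assumes "convergent_fps2 F"
  shows "convergent_fps2 (fps_deriv F)"
proof -
  obtain C R where CR: "C > 0" "R > 0" "\<And>i j. norm (fps_nth (fps_nth F j) i) \<le> C * R ^ (i + j)"
    using assms unfolding convergent_fps2_iff_bound by blast
  have "norm (fps_nth (fps_nth (fps_deriv F) j) i) \<le> (C * (2 * R)) * (2 * R) ^ (i + j)" for i j
  proof -
    have "fps_nth (fps_nth (fps_deriv F) j) i = of_nat (j + 1) * fps_nth (fps_nth F (j + 1)) i"
      by (simp add: fps_of_nat[symmetric] del: of_nat_add of_nat_Suc)
    hence "norm (fps_nth (fps_nth (fps_deriv F) j) i) = real (j + 1) * norm (fps_nth (fps_nth F (j + 1)) i)"
      by (simp add: norm_mult del: of_nat_add of_nat_Suc)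
    also have "\<dots> \<le> 2 ^ (i + j + 1) * (C * R ^ (i + (j + 1)))"
    proof (intro mult_mono CR(3))
      have "j + 1 \<le> i + j + 1" "i + j + 1 < 2 ^ (i + j + 1)" by (simp, rule less_exp)
      hence "j + 1 \<le> 2 ^ (i + j + 1)" by linarith
      hence "real (j + 1) \<le> real (2 ^ (i + j + 1))" by (rule of_nat_mono)
      thus "real (j + 1) \<le> 2 ^ (i + j + 1)" by simp
    qed auto
    finally show ?thesis by (simp add: power_mult_distrib mult_ac)
  qed
  moreover have "C * (2 * R) > 0" "2 * R > 0" using CR by auto
  ultimately show ?thesis unfolding convergent_fps2_iff_bound by blast
qed

lemma convergent_fps2_dx:
  assumes "convergent_fps2 F"
  shows "convergent_fps2 (Abs_fps (\<lambda>j. fps_deriv (fps_nth F j)))"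
proof -
  obtain C R where CR: "C > 0" "R > 0" "\<And>i j. norm (fps_nth (fps_nth F j) i) \<le> C * R ^ (i + j)"
    using assms unfolding convergent_fps2_iff_bound by blast
  have "norm (fps_nth (fps_deriv (fps_nth F j)) i) \<le> (C * (2 * R)) * (2 * R) ^ (i + j)" for i j
  proof -
    have "norm (fps_nth (fps_deriv (fps_nth F j)) i) = real (i + 1) * norm (fps_nth (fps_nth F j) (i + 1))"
      by (simp add: norm_mult del: of_nat_add of_nat_Suc)
    also have "\<dots> \<le> 2 ^ (i + j + 1) * (C * R ^ (i + 1 + j))"
    proof (intro mult_mono CR(3))
      have "i + 1 \<le> i + j + 1" "i + j + 1 < 2 ^ (i + j + 1)" by (simp, rule less_exp)
      hence "i + 1 \<le> 2 ^ (i + j + 1)" by linarith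
      hence "real (i + 1) \<le> real (2 ^ (i + j + 1))" by (rule of_nat_mono)
      thus "real (i + 1) \<le> 2 ^ (i + j + 1)" by simp
    qed auto
    finally show ?thesis by (simp add: power_mult_distrib mult_ac)
  qed
  moreover have "C * (2 * R) > 0" "2 * R > 0" using CR by auto
  ultimately show ?thesis unfolding convergent_fps2_iff_bound fps_nth_Abs_fps by blast
qed

typedef O2 = "{F :: complex fps fps. convergent_fps2 F}"
  morphisms fps_of_O2 Abs_O2
  using convergent_fps2_zero by blast

setup_lifting type_definition_O2

instantiation O2 :: idom
begin

lift_definition zero_O2 :: O2 is 0 by (rule convergent_fps2_zero)
lift_definition one_O2 :: O2 is 1
  using convergent_fps2_const[of 1] by simp
lift_definition plus_O2 :: "O2 \<Rightarrow> O2 \<Rightarrow> O2" is "(+)" by (rule convergent_fps2_add)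
lift_definition uminus_O2 :: "O2 \<Rightarrow> O2" is uminus by (rule convergent_fps2_uminus)
lift_definition minus_O2 :: "O2 \<Rightarrow> O2 \<Rightarrow> O2" is "(-)"
  unfolding diff_conv_add_uminus by (intro convergent_fps2_add convergent_fps2_uminus)
lift_definition times_O2 :: "O2 \<Rightarrow> O2 \<Rightarrow> O2" is "(*)" by (rule convergent_fps2_mult)

instance
  by standard (transfer; simp add: algebra_simps)+

end

text \<open>Exact division; this instance only serves to make the library's \<^const>\<open>coprime\<close> available.\<close>

instantiation O2 :: idom_divide
begin

definition divide_O2 :: "O2 \<Rightarrow> O2 \<Rightarrow> O2" where
  "divide_O2 a b = (if b \<noteq> 0 \<and> b dvd a then THE c. a = c * b else 0)"

instance
proof
  fix a b :: O2
  show "b \<noteq> 0 \<Longrightarrow> a * b div b = a"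
    by (auto simp: divide_O2_def intro!: the_equality)
  show "a div 0 = 0" by (simp add: divide_O2_def)
qed

end

instance O2 :: algebraic_semidom ..

lift_definition O2_const :: "complex \<Rightarrow> O2" is "\<lambda>c. fps_const (fps_const c)"
  by (rule convergent_fps2_const)

lift_definition O2_dx :: "O2 \<Rightarrow> O2" is "\<lambda>F. Abs_fps (\<lambda>j. fps_deriv (fps_nth F j))"
  by (rule convergent_fps2_dx)

lift_definition O2_dy :: "O2 \<Rightarrow> O2" is fps_deriv
  by (rule convergent_fps2_dy)

definition O2_coeff :: "O2 \<Rightarrow> nat \<Rightarrow> nat \<Rightarrow> complex" where
  "O2_coeff F i j = fps_nth (fps_nth (fps_of_O2 F) j) i"

text \<open>The value of the sum is meaningful only at points near the origin, where the series converges.\<close>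

definition O2_eval :: "O2 \<Rightarrow> complex \<times> complex \<Rightarrow> complex" where
  "O2_eval F = (\<lambda>(x, y). \<Sum>\<^sub>\<infinity>(i, j)\<in>UNIV. O2_coeff F i j * x ^ i * y ^ j)"


section \<open>Dimensions of quotients\<close>

text \<open>\<open>O2_quotient_dim S\<close> is the dimension of \<open>O2/(S)\<close> over the image of the constants in this quotient, which
  is a copy of the complex numbers unless the quotient is the zero ring (then the dimension is 0). As always for \<^const>\<open>ring.dim\<close>, the value is unspecified if the dimension is infinite.\<close>

abbreviation O2_ring :: "O2 ring" where
  "O2_ring \<equiv> ring_of_type_algebra"

definition O2_quotient_dim :: "O2 set \<Rightarrow> nat" where
  "O2_quotient_dim S =
     (let I = genideal O2_ring S; Q = O2_ring Quot I
      in ring.dim Q (range (\<lambda>c. I +>\<^bsub>O2_ring\<^esub> O2_const c)) (carrier Q))"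

definition intersection_number :: "O2 \<Rightarrow> O2 \<Rightarrow> nat" where
  "intersection_number f g = O2_quotient_dim {f, g}"

definition milnor :: "O2 \<Rightarrow> nat" where
  "milnor h = O2_quotient_dim {O2_dx h, O2_dy h}"

definition tjurina :: "O2 \<Rightarrow> nat" where
  "tjurina h = O2_quotient_dim {h, O2_dx h, O2_dy h}"


section \<open>Foliations\<close>

text \<open>A pair \<open>(A, B)\<close> stands for the 1-form \<open>A dx + B dy\<close>.\<close>

type_synonym form1 = "O2 \<times> O2"

definition omega_quotient :: "O2 \<Rightarrow> O2 \<Rightarrow> form1" where
  "omega_quotient f g = (g * O2_dx f - f * O2_dx g, g * O2_dy f - f * O2_dy g)"

definition singular_at :: "form1 \<Rightarrow> complex \<times> complex \<Rightarrow> bool" where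
  "singular_at \<omega> z \<longleftrightarrow> O2_eval (fst \<omega>) z = 0 \<and> O2_eval (snd \<omega>) z = 0"

definition isolated_singularity :: "form1 \<Rightarrow> bool" where
  "isolated_singularity \<omega> \<longleftrightarrow>
     singular_at \<omega> (0, 0) \<and> (\<forall>\<^sub>F z in at (0, 0). \<not> singular_at \<omega> z)"

definition tjurina_foliation :: "form1 \<Rightarrow> O2 \<Rightarrow> nat" where
  "tjurina_foliation \<omega> h = O2_quotient_dim {fst \<omega>, snd \<omega>, h}"

definition tjurina_divisor :: "form1 \<Rightarrow> O2 \<Rightarrow> O2 \<Rightarrow> int" where
  "tjurina_divisor \<omega> B0 Binf =
     int (tjurina_foliation \<omega> B0) - int (tjurina_foliation \<omega> Binf) + int (intersection_number B0 Binf)"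


section \<open>The pencil and its balanced divisors\<close>

text \<open>Points \<open>[\<alpha>:\<beta>]\<close> of the projective line are given by homogeneous coordinates, i.e. nonzero
  pairs, which may be proportional.\<close>

definition same_point :: "complex \<times> complex \<Rightarrow> complex \<times> complex \<Rightarrow> bool" where
  "same_point p q \<longleftrightarrow> fst p * snd q = snd p * fst q"

definition pencil_member :: "O2 \<Rightarrow> O2 \<Rightarrow> complex \<times> complex \<Rightarrow> O2" where
  "pencil_member f g p = O2_const (fst p) * f + O2_const (snd p) * g"

definition milnor_gen :: "O2 \<Rightarrow> O2 \<Rightarrow> nat" where
  "milnor_gen f g = (INF p\<in>UNIV - {(0, 0)}. milnor (pencil_member f g p))"

definition tjurina_gen :: "O2 \<Rightarrow> O2 \<Rightarrow> nat" where
  "tjurina_gen f g = (INF p\<in>UNIV - {(0, 0)}. tjurina (pencil_member f g p))"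

definition bifurcation_point :: "O2 \<Rightarrow> O2 \<Rightarrow> complex \<times> complex \<Rightarrow> bool" where
  "bifurcation_point f g p \<longleftrightarrow> p \<noteq> (0, 0) \<and> milnor (pencil_member f g p) > milnor_gen f g"

definition generic_point :: "O2 \<Rightarrow> O2 \<Rightarrow> complex \<times> complex \<Rightarrow> bool" where
  "generic_point f g p \<longleftrightarrow> p \<noteq> (0, 0) \<and>
     milnor (pencil_member f g p) = milnor_gen f g \<and> tjurina (pencil_member f g p) = tjurina_gen f g"

text \<open>The members \<open>f = 0\<close> and \<open>g = 0\<close> of the pencil sit at \<open>[1:0]\<close> and \<open>[0:1]\<close>.\<close>

definition off_axes :: "complex \<times> complex \<Rightarrow> bool" where
  "off_axes p \<longleftrightarrow> \<not> same_point p (1, 0) \<and> \<not> same_point p (0, 1)"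

text \<open>\<open>primitive_balanced f g hs \<phi>s\<close>: the divisor
  \<open>(f) + (g) + (h\<^sub>1) + \<dots> + (h\<^sub>r) - (\<phi>\<^sub>1) - \<dots> - (\<phi>\<^sub>r)\<close> is a primitive balanced divisor of separatrices.
  Here \<open>ps\<close> lists every bifurcation point other than \<open>[1:0]\<close>, \<open>[0:1]\<close> exactly once.\<close>

definition primitive_balanced :: "O2 \<Rightarrow> O2 \<Rightarrow> O2 list \<Rightarrow> O2 list \<Rightarrow> bool" where
  "primitive_balanced f g hs \<phi>s \<longleftrightarrow>
     (\<exists>ps qs. hs = map (pencil_member f g) ps \<and> \<phi>s = map (pencil_member f g) qs \<and>
        length ps = length qs \<and>
        sorted_wrt (\<lambda>p p'. \<not> same_point p p') ps \<and>
        sorted_wrt (\<lambda>q q'. \<not> same_point q q') qs \<and>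
        (\<forall>p\<in>set ps. bifurcation_point f g p \<and> off_axes p) \<and>
        (\<forall>p. bifurcation_point f g p \<and> off_axes p \<longrightarrow> (\<exists>p'\<in>set ps. same_point p p')) \<and>
        (\<forall>q\<in>set qs. generic_point f g q \<and> off_axes q))"

text \<open>The number \<open>\<Theta>\<close> attached to a factorization, given as the list of its factors.\<close>

definition Theta :: "O2 list \<Rightarrow> int" where
  "Theta fs = int (tjurina (prod_list fs)) - (\<Sum>j<length fs. int (tjurina (fs ! j)))
     - (\<Sum>j<length fs. \<Sum>i<j. int (intersection_number (fs ! i) (fs ! j)))"

end

theory Submission
  imports Defs "Jordan_Normal_Form.Determinant"
begin

text \<open>Let \<open>P = l\<^sub>1 \<dots> l\<^sub>n\<close> be a product of distinct members of the pencil and \<open>l\<close> another member. Since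
  \<open>l dl\<^sub>i - l\<^sub>i dl = c\<^sub>i \<omega>\<close> with constants \<open>c\<^sub>i \<noteq> 0\<close>, one gets \<open>l dP = n P dl + q \<omega>\<close> with
  \<open>q = \<Sum>\<^sub>i c\<^sub>i \<Prod>\<^sub>j\<^sub>\<noteq>\<^sub>i l\<^sub>j\<close>. Computing the codimension of \<open>(P, l P\<^sub>x, l P\<^sub>y)\<close> in two ways, with
  \<open>I(P, l) = n I(f, g)\<close> and \<open>I(P, q) = n (n - 1) I(f, g)\<close>, yields
  \<open>\<tau>(\<F>, P) = \<tau>(P) + n (2 - n) I(f, g)\<close>. Applied to \<open>\<B>\<^sub>0\<close> (\<open>n = r + 2\<close>) and \<open>\<B>\<^sub>\<infinity>\<close> (\<open>n = r\<close>) this leaves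
  an arithmetic identity in which the \<open>\<Theta>\<close> terms cancel.

  All dimensions involved are finite because the coefficients of \<open>\<omega>\<close> generate an ideal containing
  powers of \<open>x\<close> and \<open>y\<close>. This case of the analytic Nullstellensatz is obtained from Weierstrass
  division; it also provides the non-zero-divisors needed for the additivity of codimensions.\<close>

section \<open>Ideals and their codimension\<close>

text \<open>The auxiliary \<open>l\<close> clears a denominator: along a factor \<open>l_i\<close>
  the form is \<open>l dl_i\<close> up to a constant, so there dP is a multiple of the form only
  after multiplication by \<open>l\<close>. The same comparison supplies the finiteness of the
  Tjurina number of \<open>P\<close>, which is not a hypothesis: the ideal of P, q A, q B has finite
  codimension, equals the ideal of P, l P_x, l P_y, and so lies in the Tjurina ideal of
  \<open>P\<close>. Such finiteness has to be established at every use, since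
  \<open>ring.dim\<close> is unspecified otherwise. Codimension is therefore counted by explicit
  chains of one-dimensional extensions, and finiteness is expressed by membership of powers of both
  variables. The latter also decides cancellation: if (a, b) contains x^N and y^N, then
  \<open>b\<close> cancels modulo \<open>a\<close>, because x^N and y^N have no common factor. The
  isolated singularity enters through these powers, and the step from an analytic condition to an
  algebraic one is where most of the work lies.\<close>

definition is_ideal :: "O2 set \<Rightarrow> bool" where
  "is_ideal I \<longleftrightarrow> 0 \<in> I \<and> (\<forall>u\<in>I. \<forall>v\<in>I. u + v \<in> I) \<and> (\<forall>u\<in>I. \<forall>r. r * u \<in> I)"

text \<open>Stated as a hull so that it agrees with \<open>genideal\<close> as soon as the two
  notions of ideal are identified.\<close>

definition idl :: "O2 set \<Rightarrow> O2 set" where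
  "idl S = is_ideal hull S"

lemma is_ideal_minus:
  assumes "is_ideal I" "u \<in> I" "v \<in> I"
  shows "u - v \<in> I"
proof -
  have "(-1) * v \<in> I" using assms unfolding is_ideal_def by blast
  hence "u + (-1) * v \<in> I" using assms unfolding is_ideal_def by blast
  thus ?thesis by simp
qed

lemma is_ideal_idl: "is_ideal (idl S)"
  unfolding idl_def by (rule hull_in) (auto simp: is_ideal_def)

lemma idl_subsetI: "is_ideal I \<Longrightarrow> S \<subseteq> I \<Longrightarrow> idl S \<subseteq> I"
  unfolding idl_def by (rule hull_minimal)

lemma idl_le_idlI: "S \<subseteq> idl T \<Longrightarrow> idl S \<subseteq> idl T"
  by (intro idl_subsetI is_ideal_idl)

lemma idl_inc: "u \<in> S \<Longrightarrow> u \<in> idl S"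
  unfolding idl_def by (rule hull_inc)

lemma idl_mono: "S \<subseteq> T \<Longrightarrow> idl S \<subseteq> idl T"
  unfolding idl_def by (rule hull_mono)

lemma idl_zero: "0 \<in> idl S"
  and idl_add: "u \<in> idl S \<Longrightarrow> v \<in> idl S \<Longrightarrow> u + v \<in> idl S"
  and idl_mult: "u \<in> idl S \<Longrightarrow> r * u \<in> idl S"
  using is_ideal_idl[of S] unfolding is_ideal_def by blast+

lemma idl_mult_right: "u \<in> idl S \<Longrightarrow> u * r \<in> idl S"
  using idl_mult[of u S r] by (simp add: mult.commute)

lemma idl_diff: "u \<in> idl S \<Longrightarrow> v \<in> idl S \<Longrightarrow> u - v \<in> idl S"
  by (rule is_ideal_minus[OF is_ideal_idl])

lemma idl_empty: "idl {} = {0}"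
  by (rule antisym[OF idl_subsetI]) (auto simp: is_ideal_def idl_zero)

lemma idl_insert: "idl (insert a S) = {k * a + s | k s. s \<in> idl S}"
proof (rule antisym)
  let ?J = "{k * a + s | k s. s \<in> idl S}"
  show "idl (insert a S) \<subseteq> ?J"
  proof (rule idl_subsetI)
    show "is_ideal ?J" unfolding is_ideal_def
    proof (intro conjI ballI allI)
      show "0 \<in> ?J" by (intro CollectI exI[of _ 0]) (simp add: idl_zero)
    next
      fix u v assume "u \<in> ?J" "v \<in> ?J"
      then obtain k s k' s' where "u = k * a + s" "v = k' * a + s'" "s \<in> idl S" "s' \<in> idl S" by blast
      thus "u + v \<in> ?J"
        by (intro CollectI exI[of _ "k + k'"] exI[of _ "s + s'"]) (auto simp: algebra_simps idl_add)
    next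
      fix u r assume "u \<in> ?J"
      then obtain k s where "u = k * a + s" "s \<in> idl S" by blast
      thus "r * u \<in> ?J"
        by (intro CollectI exI[of _ "r * k"] exI[of _ "r * s"]) (auto simp: algebra_simps idl_mult)
    qed
    have "a \<in> ?J" by (intro CollectI exI[of _ 1] exI[of _ 0]) (auto simp: idl_zero)
    moreover have "u \<in> ?J" if "u \<in> S" for u
      by (intro CollectI exI[of _ 0] exI[of _ u]) (auto simp: idl_inc that)
    ultimately show "insert a S \<subseteq> ?J" by blast
  qed
  show "?J \<subseteq> idl (insert a S)"
  proof clarify
    fix k s assume "s \<in> idl S"
    hence "s \<in> idl (insert a S)" using idl_mono[of S "insert a S"] by blast
    thus "k * a + s \<in> idl (insert a S)" by (intro idl_add idl_mult[OF idl_inc]) auto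
  qed
qed

lemma idl_pair: "idl {a, b} = {k * a + l * b | k l. True}"
  by (auto simp: idl_insert idl_empty)

text \<open>Multiples of \<open>a * b\<close> are absorbed by those of \<open>a\<close>, so
  \<open>S\<close> may be enlarged to the ideal E of \<open>insert a S\<close>. The result has the
  form (a) + b E with \<open>a\<close> in E, to which multiplication by \<open>b\<close> applies as
  an isomorphism.\<close>

lemma idl_insert_image:
  "idl (insert a ((*) b ` S)) = {k * a + b * e | k e. e \<in> idl (insert a S)}" (is "_ = ?J")
proof (rule antisym)
  show "idl (insert a ((*) b ` S)) \<subseteq> ?J"
  proof (rule idl_subsetI)
    show "is_ideal ?J" unfolding is_ideal_def
    proof (intro conjI ballI allI)
      show "0 \<in> ?J" by (intro CollectI exI[of _ 0]) (simp add: idl_zero)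
    next
      fix u v assume "u \<in> ?J" "v \<in> ?J"
      then obtain k s k' s' where "u = k * a + b * s" "v = k' * a + b * s'"
        "s \<in> idl (insert a S)" "s' \<in> idl (insert a S)" by blast
      thus "u + v \<in> ?J"
        by (intro CollectI exI[of _ "k + k'"] exI[of _ "s + s'"]) (auto simp: algebra_simps idl_add)
    next
      fix u r assume "u \<in> ?J"
      then obtain k s where "u = k * a + b * s" "s \<in> idl (insert a S)" by blast
      thus "r * u \<in> ?J"
        by (intro CollectI exI[of _ "r * k"] exI[of _ "r * s"]) (auto simp: algebra_simps idl_mult)
    qed
    have "a \<in> ?J" by (intro CollectI exI[of _ 1] exI[of _ 0]) (auto simp: idl_zero)
    moreover have "b * u \<in> ?J" if "u \<in> S" for u
      by (intro CollectI exI[of _ 0] exI[of _ u]) (auto simp: idl_inc that)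
    ultimately show "insert a ((*) b ` S) \<subseteq> ?J" by blast
  qed
  have *: "b * e \<in> idl (insert a ((*) b ` S))" if "e \<in> idl (insert a S)" for e
  proof -
    have "is_ideal {e. b * e \<in> idl (insert a ((*) b ` S))}"
      unfolding is_ideal_def by (auto simp: distrib_left idl_zero idl_add mult.left_commute idl_mult)
    moreover have "insert a S \<subseteq> {e. b * e \<in> idl (insert a ((*) b ` S))}"
      by (auto intro: idl_inc idl_mult)
    ultimately show ?thesis using that idl_subsetI by blast
  qed
  thus "?J \<subseteq> idl (insert a ((*) b ` S))"
  proof clarify
    fix k e assume "e \<in> idl (insert a S)"
    with * show "k * a + b * e \<in> idl (insert a ((*) b ` S))"
      by (intro idl_add) (auto intro: idl_mult idl_inc)
  qed
qed

lemma O2_const_simps: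
  "O2_const 0 = 0" "O2_const 1 = 1"
  "O2_const (c + d) = O2_const c + O2_const d"
  "O2_const (c * d) = O2_const c * O2_const d"
  "O2_const (- c) = - O2_const c"
  "O2_const (c - d) = O2_const c - O2_const d"
  by (transfer; simp)+

section \<open>Relative dimension of subspaces over the constants\<close>

definition csubspace2 :: "O2 set \<Rightarrow> bool" where
  "csubspace2 E \<longleftrightarrow> 0 \<in> E \<and> (\<forall>u\<in>E. \<forall>v\<in>E. u + v \<in> E) \<and> (\<forall>u\<in>E. \<forall>c. O2_const c * u \<in> E)"

lemma is_ideal_imp_csubspace2: "is_ideal I \<Longrightarrow> csubspace2 I"
  unfolding is_ideal_def csubspace2_def by blast

text \<open>Mimics the library's \<open>dimension\<close>, but inside \<open>O2\<close> instead of a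
  quotient, so that chains over different ideals can be concatenated. Uniqueness of the length is
  not asserted here; it comes from the library once the chain is mapped to the quotient.\<close>

inductive reldim :: "O2 set \<Rightarrow> nat \<Rightarrow> O2 set \<Rightarrow> bool" for I where
  reldim_refl: "reldim I 0 I"
| reldim_Suc: "reldim I n E \<Longrightarrow> v \<notin> E \<Longrightarrow> reldim I (Suc n) {O2_const c * v + e | c e. e \<in> E}"

lemma csubspace2_extend:
  assumes "csubspace2 E"
  shows "csubspace2 {O2_const c * v + e | c e. e \<in> E}" (is "csubspace2 ?J")
  unfolding csubspace2_def
proof (intro conjI ballI allI)
  show "0 \<in> ?J" using assms
    by (intro CollectI exI[of _ 0]) (auto simp: csubspace2_def O2_const_simps)
next
  fix u w assume "u \<in> ?J" "w \<in> ?J"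
  then obtain k s k' s' where "u = O2_const k * v + s" "w = O2_const k' * v + s'" "s \<in> E" "s' \<in> E" by blast
  thus "u + w \<in> ?J" using assms
    by (intro CollectI exI[of _ "k + k'"] exI[of _ "s + s'"])
       (auto simp: algebra_simps O2_const_simps csubspace2_def)
next
  fix u r assume "u \<in> ?J"
  then obtain k s where "u = O2_const k * v + s" "s \<in> E" by blast
  thus "O2_const r * u \<in> ?J" using assms
    by (intro CollectI exI[of _ "r * k"] exI[of _ "O2_const r * s"])
       (auto simp: algebra_simps O2_const_simps csubspace2_def)
qed

lemma extend_superset:
  shows "E \<subseteq> {O2_const c * v + e | c e. e \<in> E}"
proof
  fix u assume "u \<in> E" thus "u \<in> {O2_const c * v + e | c e. e \<in> E}"
    by (intro CollectI exI[of _ 0] exI[of _ u]) (auto simp: O2_const_simps)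
qed

lemma reldim_csubspace2: "reldim I n E \<Longrightarrow> csubspace2 I \<Longrightarrow> csubspace2 E"
  by (induction rule: reldim.induct) (auto intro: csubspace2_extend)

lemma reldim_subset: "reldim I n E \<Longrightarrow> I \<subseteq> E"
  by (induction rule: reldim.induct) (use extend_superset in blast)+

lemma reldim_trans:
  assumes "reldim I n J" "reldim J m K"
  shows "reldim I (n + m) K"
  using assms(2) by (induction m K rule: reldim.induct) (auto intro: reldim_Suc assms(1))

text \<open>The spanning vectors are adjoined one at a time, skipping those already reached, so
  \<open>n\<close> may be smaller than the size of \<open>T\<close>.\<close>

lemma reldim_exists:
  assumes I: "csubspace2 I" and T: "finite T"
  assumes vs: "\<And>u. \<exists>c. u - (\<Sum>t\<in>T. O2_const (c t) * v t) \<in> I"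
  shows "\<exists>n. reldim I n UNIV"
proof -
  have "\<exists>n E. reldim I n E \<and> (\<forall>c. (\<Sum>t\<in>T'. O2_const (c t) * v t) \<in> E)" if "finite T'" for T'
    using that
  proof (induction T')
    case empty
    show ?case using reldim_refl[of I] I by (auto simp: csubspace2_def)
  next
    case (insert t T')
    then obtain n E where E: "reldim I n E" "\<And>c. (\<Sum>t\<in>T'. O2_const (c t) * v t) \<in> E" by blast
    have sub: "csubspace2 E" using reldim_csubspace2[OF E(1) I] .
    show ?case
    proof (cases "v t \<in> E")
      case True
      thus ?thesis using E sub insert.hyps unfolding csubspace2_def
        by (auto intro!: exI[of _ n] exI[of _ E])
    next
      case False
      have "(\<Sum>t\<in>insert t T'. O2_const (c t) * v t) \<in> {O2_const c * v t + e | c e. e \<in> E}" for c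
        using insert.hyps
        by (intro CollectI exI[of _ "c t"] exI[of _ "\<Sum>t\<in>T'. O2_const (c t) * v t"]) (simp add: E(2))
      with reldim_Suc[OF E(1) False] show ?thesis by blast
    qed
  qed
  then obtain n E where E: "reldim I n E" "\<And>c. (\<Sum>t\<in>T. O2_const (c t) * v t) \<in> E"
    using T by blast
  have "u \<in> E" for u
  proof -
    obtain c where "u - (\<Sum>t\<in>T. O2_const (c t) * v t) \<in> I" using vs by blast
    hence "(u - (\<Sum>t\<in>T. O2_const (c t) * v t)) + (\<Sum>t\<in>T. O2_const (c t) * v t) \<in> E"
      using E reldim_subset[OF E(1)] reldim_csubspace2[OF E(1) I] unfolding csubspace2_def by blast
    thus ?thesis by simp
  qed
  hence "E = UNIV" by blast
  thus ?thesis using E(1) by blast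
qed

text \<open>If \<open>b\<close> is a non-zero-divisor modulo \<open>a\<close>, multiplication by \<open>b\<close> is an isomorphism from \<open>E/I\<close>
  onto \<open>((a) + b E)/((a) + b I)\<close>.\<close>

lemma reldim_image:
  assumes "reldim I n E" "is_ideal I" "a \<in> I" "\<And>v. a dvd b * v \<Longrightarrow> a dvd v"
  shows "reldim {k * a + b * e | k e. e \<in> I} n {k * a + b * e | k e. e \<in> E}"
  using assms
proof (induction rule: reldim.induct)
  case reldim_refl
  show ?case by (rule reldim.reldim_refl)
next
  case (reldim_Suc n E v)
  let ?F = "{k * a + b * e | k e. e \<in> E}"
  have E: "csubspace2 E" "I \<subseteq> E"
    using reldim_csubspace2[OF reldim_Suc(1) is_ideal_imp_csubspace2[OF reldim_Suc(4)]]
      reldim_subset[OF reldim_Suc(1)] by auto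
  have "b * v \<notin> ?F"
  proof
    assume "b * v \<in> ?F"
    then obtain k e where ke: "b * v = k * a + b * e" "e \<in> E" by blast
    hence "b * (v - e) = a * k" by (simp add: algebra_simps)
    hence "a dvd v - e" using reldim_Suc(6) by (metis dvd_triv_left)
    then obtain l where "v - e = l * a" by (metis dvd_def mult.commute)
    moreover have "l * a \<in> E" using E reldim_Suc(4,5) unfolding is_ideal_def by blast
    ultimately have "v \<in> E" using ke(2) E(1) unfolding csubspace2_def by (metis diff_add_cancel)
    thus False using reldim_Suc(2) by blast
  qed
  from reldim.reldim_Suc[OF reldim_Suc(3)[OF reldim_Suc(4-6)] this]
  have "reldim {k * a + b * e | k e. e \<in> I} (Suc n) {O2_const c * (b * v) + e | c e. e \<in> ?F}" .
  also have "{O2_const c * (b * v) + e | c e. e \<in> ?F}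
     = {k * a + b * e | k e. e \<in> {O2_const c * v + e | c e. e \<in> E}}" (is "?L = ?R")
  proof (rule antisym; rule subsetI)
    fix u assume "u \<in> ?L"
    then obtain c k e where "u = O2_const c * (b * v) + (k * a + b * e)" "e \<in> E" by blast
    thus "u \<in> ?R"
      by (intro CollectI exI[of _ k] exI[of _ "O2_const c * v + e"]) (auto simp: algebra_simps)
  next
    fix u assume "u \<in> ?R"
    then obtain c k e where u: "u = k * a + b * (O2_const c * v + e)" "e \<in> E" by blast
    have "u = O2_const c * (b * v) + (k * a + b * e)" using u(1) by (simp add: algebra_simps)
    moreover have "k * a + b * e \<in> ?F" using u(2) by blast
    ultimately show "u \<in> ?L" by blast
  qed
  finally show ?case .
qed

section \<open>The quotient ring and its dimension over the constants\<close>

lemma O2_ring_simps: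
  "carrier O2_ring = UNIV" "x \<otimes>\<^bsub>O2_ring\<^esub> y = x * y" "x \<oplus>\<^bsub>O2_ring\<^esub> y = x + y"
  "\<one>\<^bsub>O2_ring\<^esub> = 1" "\<zero>\<^bsub>O2_ring\<^esub> = 0"
  by (simp_all add: ring_of_type_algebra_def)

lemma ideal_O2_ring_iff: "ideal I O2_ring \<longleftrightarrow> is_ideal I"
proof
  assume "ideal I O2_ring"
  then interpret ideal I O2_ring .
  show "is_ideal I" unfolding is_ideal_def
  proof (intro conjI ballI allI)
    show "0 \<in> I" using additive_subgroup.zero_closed[OF is_additive_subgroup] by (simp add: O2_ring_simps)
    show "u + v \<in> I" if "u \<in> I" "v \<in> I" for u v
      using additive_subgroup.a_closed[OF is_additive_subgroup that] by (simp add: O2_ring_simps)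
    show "r * u \<in> I" if "u \<in> I" for u r
      using I_l_closed[OF that, of r] by (simp add: O2_ring_simps)
  qed
next
  assume I: "is_ideal I"
  show "ideal I O2_ring"
  proof (rule idealI)
    show "ring O2_ring" by auto
    show "subgroup I (add_monoid O2_ring)"
    proof (rule group.subgroupI)
      interpret ring O2_ring by auto
      show "group (add_monoid O2_ring)" by (rule add.group_axioms)
      show "inv\<^bsub>add_monoid O2_ring\<^esub> a \<in> I" if "a \<in> I" for a
      proof -
        have "inv\<^bsub>add_monoid O2_ring\<^esub> a = - a"
          using add.inv_equality[of "- a" a] by (simp add: O2_ring_simps a_inv_def)
        thus ?thesis using I that unfolding is_ideal_def by (metis mult_minus1)
      qed
    qed (use I in \<open>auto simp: O2_ring_simps is_ideal_def\<close>)
  qed (use I in \<open>auto simp: O2_ring_simps is_ideal_def mult.commute\<close>)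
qed

lemma genideal_O2_ring: "genideal O2_ring S = idl S"
  unfolding genideal_def idl_def hull_def ideal_O2_ring_iff by simp

context
  fixes I :: "O2 set"
  assumes I: "is_ideal I"
begin

interpretation ideal I O2_ring using I by (simp add: ideal_O2_ring_iff)

private abbreviation (input) "cl u \<equiv> I +>\<^bsub>O2_ring\<^esub> u"
private abbreviation (input) "Q \<equiv> O2_ring Quot I"
private abbreviation (input) "K \<equiv> range (\<lambda>c. cl (O2_const c))"

interpretation h: ring_hom_ring O2_ring Q "(+>\<^bsub>O2_ring\<^esub>) I"
  by (rule rcos_ring_hom_ring)

lemma cl_eq_iff: "cl u = cl v \<longleftrightarrow> u - v \<in> I"
proof -
  have "cl u = (\<lambda>i. i + u) ` I" for u
    by (auto simp: a_r_coset_def' O2_ring_simps)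
  moreover have "(\<lambda>i. i + u) ` I = (\<lambda>i. i + v) ` I \<longleftrightarrow> u - v \<in> I"
  proof
    assume "(\<lambda>i. i + u) ` I = (\<lambda>i. i + v) ` I"
    moreover have "0 + u \<in> (\<lambda>i. i + u) ` I" using I unfolding is_ideal_def by blast
    ultimately obtain i where "u = i + v" "i \<in> I" by auto
    thus "u - v \<in> I" by simp
  next
    assume uv: "u - v \<in> I"
    have "i + u \<in> (\<lambda>i. i + v) ` I" if "i \<in> I" for i
      by (rule image_eqI[of _ _ "i + (u - v)"]) (use I that uv in \<open>auto simp: is_ideal_def\<close>)
    moreover have "i + v \<in> (\<lambda>i. i + u) ` I" if "i \<in> I" for i
      by (rule image_eqI[of _ _ "i - (u - v)"]) (use is_ideal_minus[OF I that uv] in auto)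
    ultimately show "(\<lambda>i. i + u) ` I = (\<lambda>i. i + v) ` I" by blast
  qed
  ultimately show ?thesis by simp
qed

lemma cl_add: "cl u \<oplus>\<^bsub>Q\<^esub> cl v = cl (u + v)"
  using h.hom_add[of u v] by (simp add: O2_ring_simps)

lemma cl_mult: "cl u \<otimes>\<^bsub>Q\<^esub> cl v = cl (u * v)"
  using h.hom_mult[of u v] by (simp add: O2_ring_simps)

lemma carrier_Q: "carrier Q = range cl"
  by (auto simp: FactRing_def A_RCOSETS_def' O2_ring_simps)

lemma zero_Q: "\<zero>\<^bsub>Q\<^esub> = cl 0"
  using h.hom_zero by (simp add: O2_ring_simps)

lemma one_Q: "\<one>\<^bsub>Q\<^esub> = cl 1"
  using h.hom_one by (simp add: O2_ring_simps)

lemma dimension_of_reldim: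
  assumes "reldim I n E"
  shows "ring.dimension Q n K (cl ` E)"
  using assms
proof (induction rule: reldim.induct)
  case reldim_refl
  have "cl ` I = {\<zero>\<^bsub>Q\<^esub>}"
  proof (rule antisym; rule subsetI)
    show "z \<in> {\<zero>\<^bsub>Q\<^esub>}" if "z \<in> cl ` I" for z
      using that cl_eq_iff[of _ 0] by (auto simp only: zero_Q diff_zero)
    show "z \<in> cl ` I" if "z \<in> {\<zero>\<^bsub>Q\<^esub>}" for z
      using that I unfolding zero_Q is_ideal_def by blast
  qed
  thus ?case using h.S.dimension.zero_dim by simp
next
  case (reldim_Suc n E v)
  have E: "csubspace2 E" "I \<subseteq> E"
    using reldim_csubspace2[OF reldim_Suc(1) is_ideal_imp_csubspace2[OF I]]
      reldim_subset[OF reldim_Suc(1)] by auto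
  have "cl v \<notin> cl ` E"
  proof
    assume "cl v \<in> cl ` E"
    then obtain e where e: "e \<in> E" "v - e \<in> I" by (auto simp: cl_eq_iff)
    hence "(v - e) + e \<in> E" using E unfolding csubspace2_def by blast
    thus False using reldim_Suc(2) by simp
  qed
  moreover have "cl v \<in> carrier Q" unfolding carrier_Q by blast
  ultimately have "ring.dimension Q (Suc n) K (h.S.line_extension K (cl v) (cl ` E))"
    using h.S.dimension.Suc_dim reldim_Suc(3) by blast
  also have "h.S.line_extension K (cl v) (cl ` E) = cl ` {O2_const c * v + e | c e. e \<in> E}"
  proof (rule Set.set_eqI)
    fix z
    have "z \<in> h.S.line_extension K (cl v) (cl ` E) \<longleftrightarrow> (\<exists>c. \<exists>e\<in>E. z = cl (O2_const c * v + e))"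
      unfolding h.S.line_extension_mem_iff bex_simps(7) by (simp only: cl_add cl_mult bex_UNIV)
    thus "z \<in> h.S.line_extension K (cl v) (cl ` E) \<longleftrightarrow> z \<in> cl ` {O2_const c * v + e | c e. e \<in> E}"
      by blast
  qed
  finally show ?case .
qed

lemma subfield_K:
  assumes "1 \<notin> I"
  shows "subfield K Q"
proof -
  let ?C = "ring_of_type_algebra :: complex ring"
  interpret C: field ?C by (rule field_from_type_algebra)
  have C: "carrier ?C = UNIV" "x \<otimes>\<^bsub>?C\<^esub> y = x * y" "x \<oplus>\<^bsub>?C\<^esub> y = x + y" "\<one>\<^bsub>?C\<^esub> = 1" for x y
    by (simp_all add: ring_of_type_algebra_def)
  have "ring_hom_ring ?C Q (\<lambda>c. cl (O2_const c))"
    by (rule ring_hom_ringI[OF C.ring_axioms h.S.ring_axioms])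
       (simp_all add: C cl_mult cl_add one_Q carrier_Q O2_const_simps)
  from ring_hom_ring.img_is_subfield(2)[OF this C.carrier_is_subfield]
  show ?thesis using assms by (simp add: one_Q zero_Q cl_eq_iff C)
qed

lemma ring_dim_of_reldim:
  assumes "reldim I n UNIV"
  shows "ring.dim Q K (carrier Q) = n"
proof (cases "1 \<in> I")
  case False
  show ?thesis
    using h.S.dimI[OF subfield_K[OF False] dimension_of_reldim[OF assms]]
    by (simp add: over_def carrier_Q)
next
  case True
  have "u \<in> I" for u
    using True I unfolding is_ideal_def by (metis mult.right_neutral)
  hence "I = UNIV" by blast
  have n: "n = 0"
  proof (cases rule: reldim.cases[OF assms])
    case (2 m E v)
    thus ?thesis using reldim_subset[of I m E] \<open>I = UNIV\<close> by blast
  qed simp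
  have car: "carrier Q = {\<zero>\<^bsub>Q\<^esub>}"
  proof -
    have "cl u = cl 0" for u
      unfolding cl_eq_iff by fact
    thus ?thesis unfolding carrier_Q zero_Q by blast
  qed
  have "m = 0 \<and> E = {\<zero>\<^bsub>Q\<^esub>}" if "ring.dimension Q m K E" for m E
    using that
  proof (induction rule: h.S.dimension.induct)
    case (Suc_dim v E n)
    hence "v \<in> E" unfolding car by blast
    thus ?case using Suc_dim(2) by blast
  qed simp
  moreover have "ring.dimension Q 0 K {\<zero>\<^bsub>Q\<^esub>}" by (rule h.S.dimension.zero_dim)
  ultimately have "(THE m. ring.dimension Q m K (carrier Q)) = 0"
    unfolding car by (intro the_equality) blast+
  thus ?thesis unfolding h.S.dim_def n .
qed

end

lemma O2_quotient_dim_eqI: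
  assumes "reldim (idl S) n UNIV"
  shows "O2_quotient_dim S = n"
  unfolding O2_quotient_dim_def Let_def genideal_O2_ring
  by (rule ring_dim_of_reldim[OF is_ideal_idl assms])

lemma O2_quotient_dim_cong: "idl S = idl T \<Longrightarrow> O2_quotient_dim S = O2_quotient_dim T"
  unfolding O2_quotient_dim_def genideal_O2_ring by simp

section \<open>Ideals containing powers of both variables\<close>

lift_definition O2_x :: O2 is "fps_const fps_X"
  by (rule convergent_fps2_finite, rule finite_subset[of _ "{(1, 0)}"]) (auto split: if_splits)

lift_definition O2_y :: O2 is "fps_X"
  by (rule convergent_fps2_finite, rule finite_subset[of _ "{(0, 1)}"])
     (auto simp: fps_X_def split: if_splits)

lemma O2_eqI: "(\<And>i j. O2_coeff F i j = O2_coeff G i j) \<Longrightarrow> F = G"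
  unfolding O2_coeff_def by (metis fps_ext fps_of_O2_inject)

text \<open>The offsets \<open>M\<close>, \<open>N\<close> cover shifts in either variable, offset 0
  covers truncations; a shift only costs a factor R^(M + N) in the constant.\<close>

lemma convergent_fps2_mono:
  assumes "convergent_fps2 F"
    "\<And>i j. norm (fps_nth (fps_nth G j) i) \<le> norm (fps_nth (fps_nth F (j + N)) (i + M))"
  shows "convergent_fps2 G"
proof -
  obtain C R where CR: "C > 0" "R > 0" "\<And>i j. norm (fps_nth (fps_nth F j) i) \<le> C * R ^ (i + j)"
    using assms(1) unfolding convergent_fps2_iff_bound by blast
  have "norm (fps_nth (fps_nth G j) i) \<le> (C * R ^ (M + N)) * R ^ (i + j)" for i j
  proof -
    have "norm (fps_nth (fps_nth G j) i) \<le> C * R ^ (i + M + (j + N))"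
      by (rule order_trans[OF assms(2) CR(3)])
    also have "\<dots> = (C * R ^ (M + N)) * R ^ (i + j)" by (simp add: power_add)
    finally show ?thesis .
  qed
  thus ?thesis unfolding convergent_fps2_iff_bound using CR(1,2) by (metis mult_pos_pos zero_less_power)
qed

lift_definition O2_shift_x :: "nat \<Rightarrow> O2 \<Rightarrow> O2" is "\<lambda>N F. Abs_fps (\<lambda>j. fps_shift N (fps_nth F j))"
  by (erule convergent_fps2_mono[where N = 0]) auto

lift_definition O2_shift_y :: "nat \<Rightarrow> O2 \<Rightarrow> O2" is "fps_shift"
  by (erule convergent_fps2_mono[where M = 0]) auto

lift_definition O2_cutoff_x :: "nat \<Rightarrow> O2 \<Rightarrow> O2" is "\<lambda>N F. Abs_fps (\<lambda>j. fps_cutoff N (fps_nth F j))"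
  by (erule convergent_fps2_mono[where M = 0 and N = 0]) auto

lift_definition O2_cutoff_y :: "nat \<Rightarrow> O2 \<Rightarrow> O2" is "fps_cutoff"
  by (erule convergent_fps2_mono[where M = 0 and N = 0]) auto

lemma O2_coeff_simps [simp]:
  "O2_coeff 0 i j = 0"
  "O2_coeff (F + G) i j = O2_coeff F i j + O2_coeff G i j"
  "O2_coeff (F - G) i j = O2_coeff F i j - O2_coeff G i j"
  "O2_coeff (- F) i j = - O2_coeff F i j"
  "O2_coeff (O2_const c * F) i j = c * O2_coeff F i j"
  "O2_coeff (O2_x ^ N * F) i j = (if i < N then 0 else O2_coeff F (i - N) j)"
  "O2_coeff (O2_y ^ N * F) i j = (if j < N then 0 else O2_coeff F i (j - N))"
  "O2_coeff (O2_shift_x N F) i j = O2_coeff F (i + N) j"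
  "O2_coeff (O2_shift_y N F) i j = O2_coeff F i (j + N)"
  "O2_coeff (O2_cutoff_x N F) i j = (if i < N then O2_coeff F i j else 0)"
  "O2_coeff (O2_cutoff_y N F) i j = (if j < N then O2_coeff F i j else 0)"
proof -
  have x: "fps_of_O2 (O2_x ^ N) = fps_const (fps_X ^ N)" for N
    by (induction N) (simp_all add: one_O2.rep_eq times_O2.rep_eq O2_x.rep_eq fps_const_mult)
  have y: "fps_of_O2 (O2_y ^ N) = fps_X ^ N" for N
    by (induction N) (simp_all add: one_O2.rep_eq times_O2.rep_eq O2_y.rep_eq)
  show "O2_coeff (O2_x ^ N * F) i j = (if i < N then 0 else O2_coeff F (i - N) j)"
    "O2_coeff (O2_y ^ N * F) i j = (if j < N then 0 else O2_coeff F i (j - N))"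
    by (simp_all add: O2_coeff_def times_O2.rep_eq x y fps_X_power_mult_nth)
qed (simp_all add: O2_coeff_def zero_O2.rep_eq plus_O2.rep_eq minus_O2.rep_eq uminus_O2.rep_eq
       times_O2.rep_eq O2_const.rep_eq O2_shift_x.rep_eq O2_shift_y.rep_eq
       O2_cutoff_x.rep_eq O2_cutoff_y.rep_eq)

lemma O2_coeff_sum [simp]: "O2_coeff (\<Sum>t\<in>T. F t) i j = (\<Sum>t\<in>T. O2_coeff (F t) i j)"
  by (induction T rule: infinite_finite_induct) simp_all

lemma O2_coeff_monom: "O2_coeff (O2_x ^ a * O2_y ^ b) i j = (if i = a \<and> j = b then 1 else 0)"
proof -
  have "O2_coeff (O2_y ^ b * 1) i j = (if i = 0 \<and> j = b then 1 else 0)" for i j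
    by (simp del: mult_1_right) (auto simp: O2_coeff_def one_O2.rep_eq)
  thus ?thesis by simp
qed

text \<open>A checkable form of finite codimension: the ideal is primary to the maximal ideal, or
  the whole ring. The latter (N = 0) is wanted for empty products.\<close>

definition mprimary :: "O2 set \<Rightarrow> bool" where
  "mprimary S \<longleftrightarrow> (\<exists>N. O2_x ^ N \<in> idl S \<and> O2_y ^ N \<in> idl S)"

lemma mprimaryI:
  assumes "O2_x ^ M \<in> idl S" "O2_y ^ N \<in> idl S"
  shows "mprimary S"
  unfolding mprimary_def using idl_mult[OF assms(1), of "O2_x ^ N"] idl_mult[OF assms(2), of "O2_y ^ M"]
  by (intro exI[of _ "M + N"]) (simp add: power_add mult.commute)

lemma mprimary_mono: "mprimary S \<Longrightarrow> idl S \<subseteq> idl T \<Longrightarrow> mprimary T"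
  unfolding mprimary_def by blast

lemma mprimary_iff: "idl S = idl T \<Longrightarrow> mprimary S \<longleftrightarrow> mprimary T"
  unfolding mprimary_def by simp

lemma intersection_number_cong:
  "idl {a, b} = idl {c, d} \<Longrightarrow> intersection_number a b = intersection_number c d"
  unfolding intersection_number_def by (rule O2_quotient_dim_cong)

lemma mprimary_one: "1 \<in> S \<Longrightarrow> mprimary S"
  using idl_inc[of 1 S] by (intro mprimaryI[of 0 _ 0]) auto

lemma reldim_mprimary:
  assumes "mprimary S"
  shows "\<exists>n. reldim (idl S) n UNIV"
proof -
  obtain N where N: "O2_x ^ N \<in> idl S" "O2_y ^ N \<in> idl S"
    using assms unfolding mprimary_def by blast
  let ?T = "{..<N} \<times> {..<N}"
  show ?thesis
  proof (rule reldim_exists[OF is_ideal_imp_csubspace2[OF is_ideal_idl]])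
    fix F :: O2
    let ?c = "\<lambda>(a, b). O2_coeff F a b"
    have c: "(case t of (a, b) \<Rightarrow> O2_x ^ a * O2_y ^ b) = O2_x ^ fst t * O2_y ^ snd t" for t
      by (simp add: case_prod_unfold)
    \<comment> \<open>The monomials of the square span the quotient: every other term is charged
      once, to y^N if j >= N and otherwise to x^N.\<close>
    have "F - (\<Sum>t\<in>?T. O2_const (?c t) * (case t of (a, b) \<Rightarrow> O2_x ^ a * O2_y ^ b))
        = O2_y ^ N * O2_shift_y N F + O2_x ^ N * O2_shift_x N (O2_cutoff_y N F)" (is "?L = ?R")
    proof (rule O2_eqI)
      fix i j
      have "(\<Sum>t\<in>?T. O2_coeff (O2_const (?c t) * (O2_x ^ fst t * O2_y ^ snd t)) i j)
          = (\<Sum>t\<in>?T. if t = (i, j) then O2_coeff F i j else 0)"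
        by (intro sum.cong) (auto simp: O2_coeff_monom simp del: O2_coeff_simps(6,7))
      also have "\<dots> = (if i < N \<and> j < N then O2_coeff F i j else 0)"
        by (subst sum.delta) auto
      finally show "O2_coeff ?L i j = O2_coeff ?R i j"
        unfolding c by (auto simp del: O2_coeff_simps(5))
    qed
    also have "\<dots> \<in> idl S" using N by (intro idl_add idl_mult_right)
    finally show "\<exists>c. F - (\<Sum>t\<in>?T. O2_const (c t) * (case t of (a, b) \<Rightarrow> O2_x ^ a * O2_y ^ b)) \<in> idl S"
      by blast
  qed simp
qed

lemma O2_x_power_dvd:
  assumes "O2_y ^ M * w = O2_x ^ N * w'"
  shows "O2_x ^ N dvd w"
proof -
  have "w = O2_x ^ N * O2_shift_x N w"
  proof (rule O2_eqI)
    fix i j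
    have "O2_coeff (O2_y ^ M * w) i (j + M) = O2_coeff (O2_x ^ N * w') i (j + M)"
      using assms by simp
    thus "O2_coeff w i j = O2_coeff (O2_x ^ N * O2_shift_x N w) i j" by auto
  qed
  thus ?thesis by (metis dvd_triv_left)
qed

lemma O2_x_nonzero: "O2_x \<noteq> 0"
proof
  assume "O2_x = 0"
  hence "O2_coeff (O2_x ^ 1 * O2_y ^ 0) 1 0 = 0" by simp
  thus False by (simp only: O2_coeff_monom) simp
qed

text \<open>Both x^N v and y^N v are multiples of \<open>a\<close>, say a w and a w'. Cancelling
  \<open>a\<close> gives y^N w = x^N w', so x^N divides w and can be cancelled from x^N v = a
  w.\<close>

lemma mprimary_cancel:
  assumes "mprimary {a, b}" "a dvd b * v"
  shows "a dvd v"
proof -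
  obtain N where N: "O2_x ^ N \<in> idl {a, b}" "O2_y ^ N \<in> idl {a, b}"
    using assms unfolding mprimary_def by blast
  have *: "a dvd u * v" if "u \<in> idl {a, b}" for u
  proof -
    obtain k l where u: "u = k * a + l * b" using \<open>u \<in> idl {a, b}\<close> unfolding idl_pair by blast
    have "u * v = a * (k * v) + l * (b * v)" by (simp add: u algebra_simps)
    thus ?thesis using assms(2) by simp
  qed
  obtain w where w: "O2_x ^ N * v = a * w" using *[OF N(1)] by (auto simp: dvd_def)
  obtain w' where w': "O2_y ^ N * v = a * w'" using *[OF N(2)] by (auto simp: dvd_def)
  show ?thesis
  proof (cases "a = 0")
    case True
    thus ?thesis using w O2_x_nonzero by simp
  next
    case False
    have "a * (O2_y ^ N * w) = a * (O2_x ^ N * w')"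
      using w w' by (metis mult.left_commute)
    hence "O2_y ^ N * w = O2_x ^ N * w'" using False by simp
    then obtain w'' where "w = O2_x ^ N * w''" using O2_x_power_dvd by (metis dvd_def)
    hence "O2_x ^ N * v = O2_x ^ N * (a * w'')" using w by (simp add: mult_ac)
    thus ?thesis using O2_x_nonzero by simp
  qed
qed

lemma mprimary_insert_image:
  assumes "mprimary {a, b}" "mprimary (insert a S)"
  shows "mprimary (insert a ((*) b ` S))"
proof -
  have *: "u * w \<in> idl (insert a ((*) b ` S))" if "u \<in> idl {a, b}" "w \<in> idl (insert a S)" for u w
  proof -
    obtain k l where u: "u = k * a + l * b" using \<open>u \<in> idl {a, b}\<close> unfolding idl_pair by blast
    show ?thesis unfolding idl_insert_image
      by (intro CollectI exI[of _ "k * w"] exI[of _ "l * w"]) (simp add: u algebra_simps that(2) idl_mult)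
  qed
  from assms obtain M N where "O2_x ^ M \<in> idl {a, b}" "O2_y ^ M \<in> idl {a, b}"
    "O2_x ^ N \<in> idl (insert a S)" "O2_y ^ N \<in> idl (insert a S)"
    unfolding mprimary_def by blast
  from *[OF this(1,3)] *[OF this(2,4)] show ?thesis
    by (intro mprimaryI[of "M + N" _ "M + N"]) (simp_all add: power_add)
qed

text \<open>Codimension adds along the chain (a, b S), (a, b), \<open>O2\<close>, whose lower step
  is a copy of O2/(a, S). A single element in \<open>S\<close> gives additivity of intersection
  numbers, a pair gives the comparison of Tjurina ideals.\<close>

lemma O2_quotient_dim_insert_image:
  assumes "mprimary {a, b}" "mprimary (insert a S)"
  shows "O2_quotient_dim (insert a ((*) b ` S)) = O2_quotient_dim {a, b} + O2_quotient_dim (insert a S)"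
proof -
  obtain m n where m: "reldim (idl {a, b}) m UNIV" and n: "reldim (idl (insert a S)) n UNIV"
    using assms reldim_mprimary by blast
  have "reldim {k * a + b * e | k e. e \<in> idl (insert a S)} n {k * a + b * e | k e. e \<in> UNIV}"
    by (rule reldim_image[OF n is_ideal_idl]) (auto intro: idl_inc mprimary_cancel[OF assms(1)])
  also have "{k * a + b * e | k e. e \<in> UNIV} = idl {a, b}"
    by (auto simp: idl_pair mult.commute)
  finally have "reldim (idl (insert a ((*) b ` S))) (n + m) UNIV"
    unfolding idl_insert_image[symmetric] using m by (rule reldim_trans)
  thus ?thesis
    using O2_quotient_dim_eqI m n by (metis add.commute)
qed

lemma O2_quotient_dim_one: "1 \<in> S \<Longrightarrow> O2_quotient_dim S = 0"
proof (rule O2_quotient_dim_eqI)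
  assume "1 \<in> S"
  hence "u * 1 \<in> idl S" for u by (intro idl_mult idl_inc)
  hence "idl S = UNIV" by auto
  thus "reldim (idl S) 0 UNIV" using reldim_refl[of UNIV] by simp
qed

lemma intersection_number_commute: "intersection_number a b = intersection_number b a"
  unfolding intersection_number_def by (simp add: insert_commute)

lemma intersection_number_mult:
  assumes "mprimary {a, b}" "mprimary {a, c}"
  shows "mprimary {a, b * c}"
    and "intersection_number a (b * c) = intersection_number a b + intersection_number a c"
  using O2_quotient_dim_insert_image[OF assms] mprimary_insert_image[OF assms]
  unfolding intersection_number_def by simp_all

section \<open>Products of members of a pencil\<close>

lemma O2_dx_mult: "O2_dx (F * G) = O2_dx F * G + F * O2_dx G"
  by transfer (auto simp: fps_eq_iff fps_mult_nth fps_deriv_sum sum.distrib)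

lemma O2_dy_mult: "O2_dy (F * G) = O2_dy F * G + F * O2_dy G"
  by transfer simp

lemma O2_dx_simps:
  "O2_dx (F + G) = O2_dx F + O2_dx G" "O2_dx (O2_const c) = 0" "O2_dx 1 = 0"
  by (transfer; auto simp: fps_eq_iff)+

lemma O2_dy_simps:
  "O2_dy (F + G) = O2_dy F + O2_dy G" "O2_dy (O2_const c) = 0" "O2_dy 1 = 0"
  by (transfer; simp)+


definition pencil_prod :: "O2 \<Rightarrow> O2 \<Rightarrow> (complex \<times> complex) list \<Rightarrow> O2" where
  "pencil_prod f g ps = prod_list (map (pencil_member f g) ps)"

lemma pencil_prod_simps [simp]:
  "pencil_prod f g [] = 1"
  "pencil_prod f g (p # ps) = pencil_member f g p * pencil_prod f g ps"
  by (simp_all add: pencil_prod_def)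

text \<open>For \<open>P = l\<^sub>1 \<dots> l\<^sub>n\<close> and a further member \<open>l\<close> of the pencil this is the coefficient
  \<open>\<Sum>\<^sub>i c\<^sub>i \<Prod>\<^sub>j\<^sub>\<noteq>\<^sub>i l\<^sub>j\<close> of \<open>\<omega>\<close> in the decomposition \<open>l dP = n P dl + q \<omega>\<close>.\<close>

fun pencil_cofactor :: "O2 \<Rightarrow> O2 \<Rightarrow> complex \<times> complex \<Rightarrow> (complex \<times> complex) list \<Rightarrow> O2" where
  "pencil_cofactor f g l [] = 0"
| "pencil_cofactor f g l (p # ps) =
     O2_const (snd l * fst p - fst l * snd p) * pencil_prod f g ps
     + pencil_member f g p * pencil_cofactor f g l ps"

lemma same_point_sym: "same_point p q \<longleftrightarrow> same_point q p"
  by (auto simp: same_point_def mult.commute)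

context
  fixes f g :: O2
  assumes mprimary: "mprimary {f, g}"
begin

private abbreviation (input) "pm \<equiv> pencil_member f g"
private abbreviation (input) "pp \<equiv> pencil_prod f g"
private abbreviation (input) "I0 \<equiv> intersection_number f g"

text \<open>Distinct points give an invertible 2 by 2 matrix of constants; Cramer's rule with its
  determinant \<open>D\<close> recovers \<open>f\<close> and \<open>g\<close>.\<close>

lemma idl_pencil_members:
  assumes "\<not> same_point p q"
  shows "idl {pm p, pm q} = idl {f, g}"
proof (rule antisym)
  have "pm r \<in> idl {f, g}" for r
    unfolding pencil_member_def by (intro idl_add idl_mult idl_inc) auto
  thus "idl {pm p, pm q} \<subseteq> idl {f, g}" by (intro idl_le_idlI) auto
  define D where "D = fst p * snd q - snd p * fst q"
  have D: "D \<noteq> 0" using assms unfolding same_point_def D_def by auto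
  have cancel: "u \<in> idl S" if "O2_const D * u \<in> idl S" for u S
  proof -
    have "O2_const (1 / D) * (O2_const D * u) \<in> idl S" using that by (rule idl_mult)
    also have "O2_const (1 / D) * (O2_const D * u) = O2_const (1 / D * D) * u"
      unfolding O2_const_simps by (simp add: mult.assoc)
    finally show ?thesis using D by (simp add: O2_const_simps)
  qed
  have "O2_const D * f = O2_const (snd q) * pm p - O2_const (snd p) * pm q"
    "O2_const D * g = O2_const (fst p) * pm q - O2_const (fst q) * pm p"
    unfolding D_def pencil_member_def O2_const_simps by (simp_all add: algebra_simps)
  hence "O2_const D * f \<in> idl {pm p, pm q}" "O2_const D * g \<in> idl {pm p, pm q}"
    by (simp_all add: idl_diff idl_mult idl_inc)
  thus "idl {f, g} \<subseteq> idl {pm p, pm q}"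
    by (intro idl_le_idlI) (auto intro: cancel)
qed

lemma pencil_members:
  assumes "\<not> same_point p q"
  shows "mprimary {pm p, pm q}" and "intersection_number (pm p) (pm q) = I0"
  using mprimary unfolding mprimary_iff[OF idl_pencil_members[OF assms]]
    intersection_number_cong[OF idl_pencil_members[OF assms]] by blast+

lemma member_pencil_prod:
  assumes "\<forall>p\<in>set ps. \<not> same_point l p"
  shows "mprimary {pm l, pp ps} \<and> intersection_number (pm l) (pp ps) = length ps * I0"
  using assms
proof (induction ps)
  case Nil
  show ?case by (simp add: mprimary_one intersection_number_def O2_quotient_dim_one)
next
  case (Cons p ps)
  have "mprimary {pm l, pm p}" "mprimary {pm l, pp ps}"
    using Cons by (auto intro: pencil_members)
  from intersection_number_mult[OF this] show ?case
    using Cons pencil_members(2)[of l p] by simp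
qed

lemma pencil_prod_pencil_prod:
  assumes "\<forall>p\<in>set ps. \<forall>q\<in>set qs. \<not> same_point p q"
  shows "mprimary {pp qs, pp ps} \<and> intersection_number (pp qs) (pp ps) = length ps * length qs * I0"
  using assms
proof (induction ps)
  case Nil
  show ?case by (simp add: mprimary_one intersection_number_def O2_quotient_dim_one)
next
  case (Cons p ps)
  have p: "mprimary {pp qs, pm p}" "intersection_number (pp qs) (pm p) = length qs * I0"
    using member_pencil_prod[of qs p] Cons.prems
    by (simp_all add: insert_commute intersection_number_commute)
  have "mprimary {pp qs, pp ps}" using Cons by simp
  from intersection_number_mult[OF p(1) this] show ?case
    using Cons p(2) by (simp add: algebra_simps)
qed

text \<open>Let P be the product over \<open>ps\<close> with n factors. Passing to
  \<open>p # ps\<close> replaces q by c P + p q, which is c P modulo p and p q modulo P. The two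
  parts contribute n I0 and n I0 + n (n - 1) I0, together (n + 1) n I0. Distinctness from
  \<open>l\<close> makes c nonzero.\<close>

lemma prod_cofactor:
  assumes "\<forall>p\<in>set ps. \<not> same_point l p" "sorted_wrt (\<lambda>p q. \<not> same_point p q) ps"
  defines "q \<equiv> pencil_cofactor f g l"
  shows "mprimary {pp ps, q ps} \<and>
    intersection_number (pp ps) (q ps) = length ps * (length ps - 1) * I0"
  using assms(1,2)
proof (induction ps)
  case Nil
  show ?case by (simp add: mprimary_one intersection_number_def O2_quotient_dim_one)
next
  case (Cons p ps)
  define c where "c = snd l * fst p - fst l * snd p"
  have c: "c \<noteq> 0" using Cons.prems by (auto simp: c_def same_point_def mult.commute)
  have q: "q (p # ps) = O2_const c * pp ps + pm p * q ps" by (simp add: q_def c_def)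
  have IH: "mprimary {pp ps, q ps}" "intersection_number (pp ps) (q ps) = length ps * (length ps - 1) * I0"
    using Cons by auto
  have p: "mprimary {pm p, pp ps}" "intersection_number (pm p) (pp ps) = length ps * I0"
    using member_pencil_prod[of ps p] Cons.prems by auto

  have 1: "idl {pm p, q (p # ps)} = idl {pm p, pp ps}"
  proof (rule antisym)
    show "idl {pm p, q (p # ps)} \<subseteq> idl {pm p, pp ps}"
      unfolding q by (rule idl_le_idlI) (simp add: idl_add idl_mult idl_mult_right idl_inc)
    have "pp ps = O2_const (1 / c * c) * pp ps" using c by (simp add: O2_const_simps)
    also have "\<dots> = O2_const (1 / c) * (q (p # ps) - pm p * q ps)"
      unfolding q O2_const_simps by (simp add: mult.assoc)
    also have "\<dots> \<in> idl {pm p, q (p # ps)}"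
      by (simp add: idl_mult idl_diff idl_mult_right idl_inc)
    finally show "idl {pm p, pp ps} \<subseteq> idl {pm p, q (p # ps)}"
      by (intro idl_le_idlI) (auto intro: idl_inc)
  qed
  have 1: "mprimary {q (p # ps), pm p}" "intersection_number (q (p # ps)) (pm p) = length ps * I0"
    using p mprimary_iff[OF 1] intersection_number_cong[OF 1]
    by (simp_all add: insert_commute intersection_number_commute)

  have 2: "idl {pp ps, q (p # ps)} = idl {pp ps, pm p * q ps}"
  proof (rule antisym)
    show "idl {pp ps, q (p # ps)} \<subseteq> idl {pp ps, pm p * q ps}"
      unfolding q by (rule idl_le_idlI) (simp add: idl_add idl_mult idl_inc)
    have "pm p * q ps = q (p # ps) - O2_const c * pp ps" unfolding q by simp
    also have "\<dots> \<in> idl {pp ps, q (p # ps)}"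
      by (simp add: idl_mult idl_diff idl_inc)
    finally show "idl {pp ps, pm p * q ps} \<subseteq> idl {pp ps, q (p # ps)}"
      by (intro idl_le_idlI) (auto intro: idl_inc)
  qed
  have "mprimary {pp ps, pm p}" "intersection_number (pp ps) (pm p) = length ps * I0"
    using p by (simp_all add: insert_commute intersection_number_commute)
  with intersection_number_mult[OF this(1) IH(1)] IH(2)
  have 2: "mprimary {q (p # ps), pp ps}"
    "intersection_number (q (p # ps)) (pp ps) = length ps * I0 + length ps * (length ps - 1) * I0"
    using mprimary_iff[OF 2] intersection_number_cong[OF 2]
    by (simp_all add: insert_commute[of "q (p # ps)"] intersection_number_commute[of "q (p # ps)"])

  \<comment> \<open>Subtraction is truncated, so the empty list is a case of its own.\<close>
  have "length ps * I0 + length ps * (length ps - 1) * I0 = length ps * length ps * I0"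
    by (cases ps) (simp_all add: algebra_simps)
  thus ?case
    using intersection_number_mult[OF 1(1) 2(1)] 1(2) 2(2)
    by (simp add: insert_commute[of "q (p # ps)"] intersection_number_commute[of "q (p # ps)"]
      algebra_simps)
qed

end

text \<open>Both partial derivatives are treated at once, as a derivation that kills constants. The
  term in dl is hidden in \<open>k\<close>, since only the residue modulo the product matters
  later.\<close>

lemma pencil_prod_differential:
  assumes "D = O2_dx \<and> w = fst (omega_quotient f g) \<or> D = O2_dy \<and> w = snd (omega_quotient f g)"
  shows "\<exists>k. pencil_member f g l * D (pencil_prod f g ps)
    = k * pencil_prod f g ps + pencil_cofactor f g l ps * w"
proof -
  have D: "D (F * G) = D F * G + F * D G" "D (F + G) = D F + D G" "D (O2_const c) = 0" "D 1 = 0"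
    and w: "w = g * D f - f * D g" for F G c
    using assms by (auto simp: O2_dx_mult O2_dy_mult O2_dx_simps O2_dy_simps omega_quotient_def)
  let ?m = "pencil_member f g"
  show ?thesis
  proof (induction ps)
    case Nil
    show ?case by (simp add: D)
  next
    case (Cons p ps)
    then obtain k where k: "?m l * D (pencil_prod f g ps)
      = k * pencil_prod f g ps + pencil_cofactor f g l ps * w" by blast
    \<comment> \<open>The terms in f D f and g D g cancel, which leaves the determinant of the two
      coordinate pairs as the factor of \<open>w\<close>.\<close>
    have m: "?m l * D (?m p) = ?m p * D (?m l) + O2_const (snd l * fst p - fst l * snd p) * w"
      unfolding w pencil_member_def D O2_const_simps by (simp add: algebra_simps)
    have "?m l * D (pencil_prod f g (p # ps))
      = (?m l * D (?m p)) * pencil_prod f g ps + ?m p * (?m l * D (pencil_prod f g ps))"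
      by (simp add: D algebra_simps)
    also have "\<dots> = (D (?m l) + k) * pencil_prod f g (p # ps) + pencil_cofactor f g l (p # ps) * w"
      unfolding m k by (simp add: algebra_simps)
    finally show ?case by blast
  qed
qed

text \<open>Among the points [1 : t] each nonzero pair excludes at most one slope t. The zero pair
  is ruled out because \<open>same_point\<close> relates it to everything.\<close>

lemma obtain_other_point:
  assumes "(0, 0) \<notin> set ps"
  obtains l where "\<forall>p\<in>set ps. \<not> same_point l p"
proof -
  obtain t :: complex where t: "t \<notin> (\<lambda>p. snd p / fst p) ` set ps"
    using ex_new_if_finite[OF infinite_UNIV_char_0] by (metis finite_imageI finite_set)
  have "\<not> same_point (1, t) p" if "p \<in> set ps" for p
  proof
    assume "same_point (1, t) p"
    hence *: "snd p = t * fst p" by (simp add: same_point_def)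
    hence "fst p \<noteq> 0" using assms that by (metis mult_zero_right prod.collapse)
    hence "t = snd p / fst p" using * by simp
    thus False using t that by blast
  qed
  thus ?thesis using that by blast
qed

text \<open>Modulo \<open>P\<close> the forms \<open>l dP\<close> and \<open>q \<omega>\<close> agree, so both Tjurina numbers are compared with the
  codimension of \<open>(P, l P\<^sub>x, l P\<^sub>y)\<close>.\<close>

lemma tjurina_foliation_pencil_prod:
  fixes f g :: O2 and ps :: "(complex \<times> complex) list"
  defines "n \<equiv> int (length ps)" and "P \<equiv> pencil_prod f g ps"
  assumes prim: "mprimary {f, g}" "mprimary {fst (omega_quotient f g), snd (omega_quotient f g)}"
    and ps: "sorted_wrt (\<lambda>p q. \<not> same_point p q) ps" "(0, 0) \<notin> set ps"
  shows "int (tjurina_foliation (omega_quotient f g) P)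
    = int (tjurina P) + n * (2 - n) * int (intersection_number f g)"
proof -
  obtain l where l: "\<forall>p\<in>set ps. \<not> same_point l p" using obtain_other_point[OF ps(2)] .
  define A where "A = fst (omega_quotient f g)"
  define B where "B = snd (omega_quotient f g)"
  define q where "q = pencil_cofactor f g l ps"
  define m where "m = pencil_member f g l"
  have Pq: "mprimary {P, q}" "O2_quotient_dim {P, q} = length ps * (length ps - 1) * intersection_number f g"
    using prod_cofactor[OF prim(1) l ps(1)] unfolding P_def q_def intersection_number_def by auto
  have Pm: "mprimary {P, m}" "O2_quotient_dim {P, m} = length ps * intersection_number f g"
    using member_pencil_prod[OF prim(1) l] unfolding P_def m_def intersection_number_def
    by (simp_all add: insert_commute)
  have PAB: "mprimary {P, A, B}"
    using mprimary_mono[OF prim(2)] unfolding A_def B_def by (meson idl_mono subset_insertI)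
  obtain k where k: "m * O2_dx P = k * P + q * A"
    using pencil_prod_differential unfolding m_def P_def q_def A_def by blast
  obtain k' where k': "m * O2_dy P = k' * P + q * B"
    using pencil_prod_differential unfolding m_def P_def q_def B_def by blast
  have eq: "idl {P, q * A, q * B} = idl {P, m * O2_dx P, m * O2_dy P}"
  proof (rule antisym; rule idl_le_idlI)
    have "q * A = m * O2_dx P - k * P" "q * B = m * O2_dy P - k' * P" using k k' by simp_all
    thus "{P, q * A, q * B} \<subseteq> idl {P, m * O2_dx P, m * O2_dy P}"
      by (simp add: idl_diff idl_mult idl_inc)
    show "{P, m * O2_dx P, m * O2_dy P} \<subseteq> idl {P, q * A, q * B}"
      unfolding k k' by (simp add: idl_add idl_mult idl_inc)
  qed
  \<comment> \<open>Finiteness of the Tjurina number of \<open>P\<close>: it passes from this ideal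
    through \<open>eq\<close> to the larger Tjurina ideal.\<close>
  have "mprimary {P, q * A, q * B}"
    using mprimary_insert_image[OF Pq(1) PAB] by simp
  hence "mprimary {P, m * O2_dx P, m * O2_dy P}" unfolding mprimary_def eq .
  moreover have "idl {P, m * O2_dx P, m * O2_dy P} \<subseteq> idl {P, O2_dx P, O2_dy P}"
    by (rule idl_le_idlI) (simp add: idl_mult idl_inc)
  ultimately have Pd: "mprimary {P, O2_dx P, O2_dy P}" by (rule mprimary_mono)
  have "O2_quotient_dim {P, q} + O2_quotient_dim {P, A, B}
      = O2_quotient_dim {P, m} + O2_quotient_dim {P, O2_dx P, O2_dy P}"
    using O2_quotient_dim_insert_image[OF Pq(1) PAB] O2_quotient_dim_insert_image[OF Pm(1) Pd]
      O2_quotient_dim_cong[OF eq] by simp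
  moreover have "O2_quotient_dim {P, A, B} = tjurina_foliation (omega_quotient f g) P"
    unfolding tjurina_foliation_def A_def B_def by (simp add: insert_commute)
  moreover have "int (O2_quotient_dim {P, q}) = n * (n - 1) * int (intersection_number f g)"
    unfolding Pq(2) n_def by (cases ps) (simp_all add: algebra_simps)
  moreover have "int (O2_quotient_dim {P, m}) = n * int (intersection_number f g)"
    unfolding Pm(2) n_def by simp
  ultimately have "n * (n - 1) * int (intersection_number f g)
      + int (tjurina_foliation (omega_quotient f g) P) = n * int (intersection_number f g) + int (tjurina P)"
    unfolding tjurina_def by linarith
  thus ?thesis by (simp add: algebra_simps)
qed

section \<open>Evaluation near the origin\<close>

text \<open>Bidiscs instead of balls: later y is frozen while x runs through a full disc of fixed
  radius.\<close>

lemma eventually_nhds_origin_iff: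
  "eventually P (nhds (0, 0 :: 'b :: real_normed_vector))
     \<longleftrightarrow> (\<exists>\<delta>>0. \<forall>x y. norm (x :: 'a :: real_normed_vector) < \<delta> \<longrightarrow> norm y < \<delta> \<longrightarrow> P (x, y))"
proof
  assume "eventually P (nhds (0, 0 :: 'b))"
  then obtain d where d: "d > 0" "\<And>z. dist z (0, 0) < d \<Longrightarrow> P z"
    unfolding eventually_nhds_metric by blast
  have "P (x, y)" if "norm x < d / 2" "norm y < d / 2" for x y
  proof (rule d(2))
    have "dist (x, y) (0, 0) \<le> norm x + norm y"
      by (simp add: dist_Pair_Pair sqrt_sum_squares_le_sum)
    thus "dist (x, y) (0, 0) < d" using that by linarith
  qed
  thus "\<exists>\<delta>>0. \<forall>x y. norm x < \<delta> \<longrightarrow> norm y < \<delta> \<longrightarrow> P (x, y)"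
    using d(1) by (intro exI[of _ "d / 2"]) auto
next
  assume "\<exists>\<delta>>0. \<forall>x y. norm x < \<delta> \<longrightarrow> norm y < \<delta> \<longrightarrow> P (x, y)"
  then obtain d where d: "d > 0" "\<And>x y. norm x < d \<Longrightarrow> norm y < d \<Longrightarrow> P (x, y)" by blast
  have "P z" if "dist z (0, 0) < d" for z
    using d(2)[of "fst z" "snd z"] dist_fst_le[of z "(0, 0)"] dist_snd_le[of z "(0, 0)"] that by simp
  thus "eventually P (nhds (0, 0 :: 'b))" unfolding eventually_nhds_metric using d(1) by blast
qed

lemma O2_coeff_bound:
  obtains C R where "C > 0" "R > 0" "\<And>i j. norm (O2_coeff F i j) \<le> C * R ^ (i + j)"
  using fps_of_O2[of F] unfolding mem_Collect_eq convergent_fps2_iff_bound O2_coeff_def by blast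

definition slice :: "O2 \<Rightarrow> complex \<Rightarrow> complex fps" where
  "slice F x = Abs_fps (\<lambda>j. eval_fps (fps_nth (fps_of_O2 F) j) x)"

text \<open>Conditions under which the double series is an iterated one-variable evaluation, by
  restriction to a vertical line. Sums and products then reduce to the rules for
  \<open>eval_fps\<close>.\<close>

definition evaluable :: "O2 \<Rightarrow> complex \<times> complex \<Rightarrow> bool" where
  "evaluable F z \<longleftrightarrow> (\<forall>j. norm (fst z) < fps_conv_radius (fps_nth (fps_of_O2 F) j)) \<and>
     norm (snd z) < fps_conv_radius (slice F (fst z)) \<and>
     O2_eval F z = eval_fps (slice F (fst z)) (snd z)"

lemma geometric_half_pairs:
  assumes "C \<ge> 0"
  shows "(\<lambda>(i, j). C * (1/2) ^ i * (1/2) ^ j :: real) summable_on (UNIV :: (nat \<times> nat) set)"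
proof -
  have geo: "((\<lambda>i. (1/2) ^ i :: real) has_sum 2) UNIV"
    using norm_summable_imp_has_sum[OF _ geometric_sums[of "1/2 :: real"]]
      summable_geometric[of "1/2 :: real"] by simp
  have "(\<lambda>(i, j). C * (1/2) ^ i * (1/2) ^ j :: real) summable_on (UNIV :: nat set) \<times> (UNIV :: nat set)"
  proof (rule summable_on_SigmaI[where g = "\<lambda>i. C * (1/2) ^ i * 2"])
    show "((\<lambda>j. case (i, j) of (i, j) \<Rightarrow> C * (1/2) ^ i * (1/2) ^ j) has_sum (C * (1/2) ^ i * 2)) UNIV" for i :: nat
      using has_sum_cmult_right[OF geo] by simp
    show "(\<lambda>i. C * (1/2) ^ i * 2) summable_on (UNIV :: nat set)"
      by (intro summable_on_cmult_left summable_on_cmult_right has_sum_imp_summable[OF geo])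
  qed (use assms in auto)
  thus ?thesis by simp
qed

text \<open>For a coefficient bound C R^(i + j), the radius 1/(2 R) makes each variable contribute a
  factor 1/2 per degree.\<close>

lemma O2_eval_term_bound:
  obtains C \<delta> where "C > 0" "\<delta> > 0"
    "\<And>i j x y. norm x \<le> \<delta> \<Longrightarrow> norm y \<le> \<delta> \<Longrightarrow> norm (O2_coeff F i j * x ^ i * y ^ j) \<le> C * (1/2) ^ i * (1/2) ^ j"
proof -
  obtain C R where CR: "C > 0" "R > 0" "\<And>i j. norm (O2_coeff F i j) \<le> C * R ^ (i + j)"
    using O2_coeff_bound[of F] by blast
  have "norm (O2_coeff F i j * x ^ i * y ^ j) \<le> C * (1/2) ^ i * (1/2) ^ j"
    if "norm x \<le> 1 / (2 * R)" "norm y \<le> 1 / (2 * R)" for x y i j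
  proof -
    have "norm (O2_coeff F i j * x ^ i * y ^ j) = norm (O2_coeff F i j) * norm x ^ i * norm y ^ j"
      by (simp add: norm_mult norm_power)
    also have "\<dots> \<le> (C * R ^ (i + j)) * (1 / (2 * R)) ^ i * (1 / (2 * R)) ^ j"
      using CR that by (intro mult_mono power_mono CR(3)) auto
    also have "\<dots> = C * (R * (1 / (2 * R))) ^ i * (R * (1 / (2 * R))) ^ j"
      unfolding power_mult_distrib by (simp add: power_add)
    also have "R * (1 / (2 * R)) = 1 / 2" using CR by simp
    finally show ?thesis .
  qed
  thus ?thesis using that[of C "1 / (2 * R)"] CR by simp
qed

lemma summable_half: "summable (\<lambda>n. C * (1/2 :: real) ^ n)"
  by (intro summable_mult summable_geometric) simp

text \<open>Domination by a double geometric series allows the sum to be taken first over i, then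
  over j.\<close>

lemma eventually_evaluable: "\<forall>\<^sub>F z in nhds (0, 0). evaluable F z"
proof -
  obtain C \<delta> where C: "C > 0" and \<delta>: "\<delta> > 0" and
    bd: "\<And>i j x y. norm x \<le> \<delta> \<Longrightarrow> norm y \<le> \<delta> \<Longrightarrow> norm (O2_coeff F i j * x ^ i * y ^ j) \<le> C * (1/2) ^ i * (1/2) ^ j"
    using O2_eval_term_bound[of F] by blast
  have sum_x: "summable (\<lambda>i. norm (O2_coeff F i j * x ^ i))" if x: "norm x \<le> \<delta>" for x j
  proof -
    \<comment> \<open>The two-variable bound is used at y = \<open>\<delta>\<close>; the factor
      \<open>\<delta> ^ j\<close> is divided out afterwards.\<close>
    have "summable (\<lambda>i. norm (O2_coeff F i j * x ^ i) * \<delta> ^ j)"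
    proof (rule summable_comparison_test[OF _ summable_half])
      show "\<exists>N. \<forall>n\<ge>N. norm (norm (O2_coeff F n j * x ^ n) * \<delta> ^ j) \<le> (C * (1/2) ^ j) * (1/2) ^ n"
        using bd[OF x, of "of_real \<delta>" _ j] \<delta> by (simp add: norm_mult norm_power mult_ac)
    qed
    from summable_mult2[OF this, of "1 / \<delta> ^ j"] show ?thesis using \<delta> by simp
  qed
  have "evaluable F (x, y)" if x: "norm x < \<delta>" and y: "norm y < \<delta>" for x y
  proof -
    have rad: "norm x < fps_conv_radius (fps_nth (fps_of_O2 F) j)" for j
    proof -
      have "summable (\<lambda>i. fps_nth (fps_nth (fps_of_O2 F) j) i * of_real \<delta> ^ i)"
        using sum_x[of "of_real \<delta>" j] \<delta> by (auto simp: O2_coeff_def intro: summable_norm_cancel)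
      from conv_radius_geI[OF this] have "ereal \<delta> \<le> fps_conv_radius (fps_nth (fps_of_O2 F) j)"
        using \<delta> by (simp add: fps_conv_radius_def)
      thus ?thesis using x by (meson ereal_less_eq(3) less_ereal.simps(1) order_less_le_trans)
    qed
    have sl: "(\<lambda>i. O2_coeff F i j * x ^ i) sums fps_nth (slice F x) j" for j
      using sums_eval_fps[OF rad] by (simp add: slice_def O2_coeff_def)
    have slbd: "norm (fps_nth (slice F x) j * w ^ j) \<le> (C * 2) * (1/2) ^ j" if w: "norm w \<le> \<delta>" for j w
    proof -
      have "(\<lambda>i. O2_coeff F i j * x ^ i * w ^ j) sums (fps_nth (slice F x) j * w ^ j)"
        using sums_mult2[OF sl] by simp
      hence "fps_nth (slice F x) j * w ^ j = (\<Sum>i. O2_coeff F i j * x ^ i * w ^ j)"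
        by (simp add: sums_iff)
      also have "norm \<dots> \<le> (\<Sum>i. (C * (1/2) ^ j) * (1/2) ^ i)"
      proof (rule norm_suminf_le)
        show "norm (O2_coeff F i j * x ^ i * w ^ j) \<le> C * (1/2) ^ j * (1/2) ^ i" for i
          using bd[of x w i j] x w by (simp add: mult_ac)
      qed (rule summable_half)
      also have "\<dots> = (C * (1/2) ^ j) * 2"
        by (subst suminf_mult) (auto simp: suminf_geometric intro: summable_geometric)
      finally show ?thesis by simp
    qed
    have "summable (\<lambda>j. fps_nth (slice F x) j * of_real \<delta> ^ j)"
      by (rule summable_comparison_test[OF _ summable_half]) (use slbd[of "of_real \<delta>"] \<delta> in auto)
    from conv_radius_geI[OF this] have "ereal \<delta> \<le> fps_conv_radius (slice F x)"
      using \<delta> by (simp add: fps_conv_radius_def)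
    hence rad2: "norm y < fps_conv_radius (slice F x)"
      using y by (meson ereal_less_eq(3) less_ereal.simps(1) order_less_le_trans)

    let ?f = "\<lambda>i j. O2_coeff F i j * x ^ i * y ^ j"
    have abs: "(\<lambda>(i, j). norm (?f i j)) summable_on (UNIV :: (nat \<times> nat) set)"
      by (rule summable_on_comparison_test[OF geometric_half_pairs[OF less_imp_le[OF C]]]) (use bd[of x y] x y in auto)
    hence summ: "(\<lambda>(i, j). ?f i j) summable_on (UNIV \<times> UNIV)"
      using abs_summable_summable[of "\<lambda>(i, j). ?f i j" UNIV] by (simp add: case_prod_unfold)
    have "O2_eval F (x, y) = (\<Sum>\<^sub>\<infinity>i. \<Sum>\<^sub>\<infinity>j. ?f i j)"
      using infsum_Sigma_banach[OF summ] by (simp add: O2_eval_def)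
    also have "\<dots> = (\<Sum>\<^sub>\<infinity>j. \<Sum>\<^sub>\<infinity>i. ?f i j)"
      by (rule infsum_swap_banach[OF summ])
    also have "\<dots> = (\<Sum>\<^sub>\<infinity>j. fps_nth (slice F x) j * y ^ j)"
    proof (rule infsum_cong)
      fix j
      have "((\<lambda>i. ?f i j) has_sum (fps_nth (slice F x) j * y ^ j)) UNIV"
      proof (rule norm_summable_imp_has_sum)
        show "summable (\<lambda>i. norm (?f i j))"
          using summable_mult2[OF sum_x[of x j], of "norm y ^ j"] x by (simp add: norm_mult norm_power)
        show "(\<lambda>i. ?f i j) sums (fps_nth (slice F x) j * y ^ j)" using sums_mult2[OF sl] by simp
      qed
      thus "(\<Sum>\<^sub>\<infinity>i. ?f i j) = fps_nth (slice F x) j * y ^ j" by (rule infsumI)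
    qed
    also have "\<dots> = eval_fps (slice F x) y"
      by (rule infsumI, rule norm_summable_imp_has_sum[OF norm_summable_fps[OF rad2] sums_eval_fps[OF rad2]])
    finally show ?thesis using rad rad2 by (simp add: evaluable_def)
  qed
  thus ?thesis unfolding eventually_nhds_origin_iff using \<delta> by blast
qed

lemma eventually_isCont_O2_eval: "\<forall>\<^sub>F z in nhds (0, 0). isCont (O2_eval F) z"
proof -
  obtain C \<delta> where C: "C > 0" and \<delta>: "\<delta> > 0" and
    bd: "\<And>i j x y. norm x \<le> \<delta> \<Longrightarrow> norm y \<le> \<delta> \<Longrightarrow> norm (O2_coeff F i j * x ^ i * y ^ j) \<le> C * (1/2) ^ i * (1/2) ^ j"
    using O2_eval_term_bound[of F] by blast
  let ?D = "ball (0 :: complex) \<delta> \<times> ball (0 :: complex) \<delta>"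
  let ?f = "\<lambda>t z. O2_coeff F (fst t) (snd t) * fst z ^ fst t * snd z ^ snd t"
  have "uniform_limit ?D (\<lambda>T z. \<Sum>t\<in>T. ?f t z) (\<lambda>z. infsum (\<lambda>t. ?f t z) UNIV) (finite_subsets_at_top UNIV)"
    by (rule Weierstrass_m_test_general[OF _ geometric_half_pairs[OF less_imp_le[OF C]]])
       (use bd in \<open>auto simp: case_prod_unfold\<close>)
  hence "continuous_on ?D (\<lambda>z. infsum (\<lambda>t. ?f t z) UNIV)"
    by (rule uniform_limit_theorem[rotated]) (auto intro!: always_eventually continuous_intros)
  also have "(\<lambda>z. infsum (\<lambda>t. ?f t z) UNIV) = O2_eval F"
    by (simp add: O2_eval_def case_prod_unfold)
  finally have "isCont (O2_eval F) z" if "z \<in> ?D" for z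
    using that by (intro continuous_on_interior[of ?D]) (simp_all add: interior_open open_Times)
  thus ?thesis unfolding eventually_nhds_origin_iff using \<delta> by (intro exI[of _ \<delta>]) auto
qed

lemma O2_eval_origin: "O2_eval F (0, 0) = O2_coeff F 0 0"
proof -
  have "O2_eval F (0, 0) = (\<Sum>\<^sub>\<infinity>t\<in>{(0 :: nat, 0 :: nat)}. O2_coeff F 0 0)"
    unfolding O2_eval_def prod.case by (rule infsum_cong_neutral) (auto simp: power_0_left split: if_splits)
  thus ?thesis by simp
qed

lemma slice_add:
  assumes "evaluable F (x, y)" "evaluable G (x, y)"
  shows "slice (F + G) x = slice F x + slice G x"
  using assms by (simp add: fps_eq_iff slice_def evaluable_def plus_O2.rep_eq eval_fps_add)

lemma eval_fps_sum:
  assumes "finite T" "\<And>t. t \<in> T \<Longrightarrow> norm z < fps_conv_radius (F t)"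
  shows "norm z < fps_conv_radius (\<Sum>t\<in>T. F t) \<and> eval_fps (\<Sum>t\<in>T. F t) z = (\<Sum>t\<in>T. eval_fps (F t) (z :: complex))"
  using assms
proof (induction T)
  case (insert t T)
  have "norm z < min (fps_conv_radius (F t)) (fps_conv_radius (\<Sum>t\<in>T. F t))"
    using insert by (simp add: min_def)
  hence "norm z < fps_conv_radius (F t + (\<Sum>t\<in>T. F t))"
    using fps_conv_radius_add by (rule order_less_le_trans)
  thus ?case using insert by (simp add: eval_fps_add)
qed simp

lemma slice_mult:
  assumes "evaluable F (x, y)" "evaluable G (x, y)"
  shows "slice (F * G) x = slice F x * slice G x"
proof (rule fps_ext)
  fix n
  let ?F = "fps_nth (fps_of_O2 F)" and ?G = "fps_nth (fps_of_O2 G)"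
  have r: "norm x < fps_conv_radius (?F j)" "norm x < fps_conv_radius (?G j)" for j
    using assms by (simp_all add: evaluable_def)
  have "norm x < fps_conv_radius (?F i * ?G j)" for i j
    using fps_conv_radius_mult[of "?F i" "?G j"] r[of i] r[of j] by (auto simp: min_def split: if_splits)
  hence "fps_nth (slice (F * G) x) n = (\<Sum>i=0..n. eval_fps (?F i * ?G (n - i)) x)"
    by (simp add: slice_def times_O2.rep_eq fps_mult_nth eval_fps_sum)
  also have "\<dots> = fps_nth (slice F x * slice G x) n"
    by (simp add: slice_def fps_mult_nth eval_fps_mult r)
  finally show "fps_nth (slice (F * G) x) n = fps_nth (slice F x * slice G x) n" .
qed

lemma eventually_O2_eval_add:
  "\<forall>\<^sub>F z in nhds (0, 0). O2_eval (F + G) z = O2_eval F z + O2_eval G z"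
  using eventually_evaluable[of F] eventually_evaluable[of G] eventually_evaluable[of "F + G"]
proof eventually_elim
  case (elim z)
  thus ?case using slice_add[of F "fst z" "snd z" G] by (simp add: evaluable_def eval_fps_add)
qed

lemma eventually_O2_eval_mult:
  "\<forall>\<^sub>F z in nhds (0, 0). O2_eval (F * G) z = O2_eval F z * O2_eval G z"
  using eventually_evaluable[of F] eventually_evaluable[of G] eventually_evaluable[of "F * G"]
proof eventually_elim
  case (elim z)
  thus ?case using slice_mult[of F "fst z" "snd z" G] by (simp add: evaluable_def eval_fps_mult)
qed

lemma O2_eval_simps:
  "O2_eval 0 z = 0" "O2_eval (O2_const c) z = c" "O2_eval 1 z = 1" "O2_eval O2_x z = fst z"
proof -
  have *: "O2_eval F z = O2_coeff F a b * fst z ^ a * snd z ^ b"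
    if "\<And>i j. (i, j) \<noteq> (a, b) \<Longrightarrow> O2_coeff F i j = 0" for F a b
  proof -
    have "O2_eval F z = (\<Sum>\<^sub>\<infinity>t\<in>{(a, b)}. O2_coeff F a b * fst z ^ a * snd z ^ b)"
      unfolding O2_eval_def case_prod_unfold
      by (rule infsum_cong_neutral) (use that in auto)
    thus ?thesis by simp
  qed
  show 0: "O2_eval 0 z = 0" using *[of 0 0 0] by simp
  show c: "O2_eval (O2_const c) z = c" for c
  proof -
    have "O2_coeff (O2_const c) i j = (if i = 0 \<and> j = 0 then c else 0)" for i j
      by (simp add: O2_coeff_def O2_const.rep_eq)
    thus ?thesis by (subst *[of 0 0]) auto
  qed
  show "O2_eval 1 z = 1" using c[of 1] by (simp add: O2_const_simps)
  have "O2_coeff O2_x i j = (if i = 1 \<and> j = 0 then 1 else 0)" for i j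
    using O2_coeff_monom[of 1 0 i j] by simp
  thus "O2_eval O2_x z = fst z" using *[of 1 0 O2_x] by auto
qed

lemma eventually_O2_eval_sum:
  assumes "finite T"
  shows "\<forall>\<^sub>F z in nhds (0, 0). O2_eval (\<Sum>t\<in>T. F t) z = (\<Sum>t\<in>T. O2_eval (F t) z)"
  using assms
proof (induction T)
  case (insert t T)
  from insert(3) eventually_O2_eval_add[of "F t" "\<Sum>t\<in>T. F t"]
  show ?case by eventually_elim (use insert in simp)
qed (simp add: O2_eval_simps)

lemma eventually_O2_eval_prod:
  assumes "finite T"
  shows "\<forall>\<^sub>F z in nhds (0, 0). O2_eval (\<Prod>t\<in>T. F t) z = (\<Prod>t\<in>T. O2_eval (F t) z)"
  using assms
proof (induction T)
  case (insert t T)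
  from insert(3) eventually_O2_eval_mult[of "F t" "\<Prod>t\<in>T. F t"]
  show ?case by eventually_elim (use insert in simp)
qed (simp add: O2_eval_simps)

lemma eventually_O2_eval_power:
  "\<forall>\<^sub>F z in nhds (0, 0). O2_eval (F ^ n) z = O2_eval F z ^ n"
  using eventually_O2_eval_prod[of "{..<n}" "\<lambda>_. F"] by simp

section \<open>Weierstrass division\<close>

text \<open>The weighted \<open>\<ell>\<^sup>1\<close>-norm is bounded through its partial sums, so that no summability has to be
  carried along.\<close>

definition l1_bound :: "real \<Rightarrow> complex fps \<Rightarrow> real \<Rightarrow> bool" where
  "l1_bound s F c \<longleftrightarrow> (\<forall>n. (\<Sum>j<n. norm (fps_nth F j) * s ^ j) \<le> c)"

lemma l1_bound_diff:
  assumes "l1_bound s F a" "l1_bound s G b" "s > 0"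
  shows "l1_bound s (F - G) (a + b)"
  unfolding l1_bound_def
proof
  fix n
  have "(\<Sum>j<n. norm (fps_nth (F - G) j) * s ^ j)
      \<le> (\<Sum>j<n. norm (fps_nth F j) * s ^ j + norm (fps_nth G j) * s ^ j)"
    unfolding distrib_right[symmetric] using assms(3)
    by (intro sum_mono mult_right_mono) (auto intro: norm_triangle_ineq4)
  also have "\<dots> \<le> a + b" using assms unfolding l1_bound_def sum.distrib by (intro add_mono) auto
  finally show "(\<Sum>j<n. norm (fps_nth (F - G) j) * s ^ j) \<le> a + b" .
qed

lemma l1_bound_sum:
  assumes "\<And>t. t \<in> T \<Longrightarrow> l1_bound s (F t) (a t)" "s > 0"
  shows "l1_bound s (\<Sum>t\<in>T. F t) (\<Sum>t\<in>T. a t)"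
  unfolding l1_bound_def
proof
  fix n
  have "(\<Sum>j<n. norm (fps_nth (\<Sum>t\<in>T. F t) j) * s ^ j)
      \<le> (\<Sum>j<n. \<Sum>t\<in>T. norm (fps_nth (F t) j) * s ^ j)"
    unfolding fps_sum_nth sum_distrib_right[symmetric] using assms(2)
    by (intro sum_mono mult_right_mono norm_sum) auto
  also have "\<dots> = (\<Sum>t\<in>T. \<Sum>j<n. norm (fps_nth (F t) j) * s ^ j)" by (rule sum.swap)
  also have "\<dots> \<le> (\<Sum>t\<in>T. a t)" using assms(1) unfolding l1_bound_def by (intro sum_mono) auto
  finally show "(\<Sum>j<n. norm (fps_nth (\<Sum>t\<in>T. F t) j) * s ^ j) \<le> (\<Sum>t\<in>T. a t)" .
qed

lemma l1_bound_mult: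
  assumes "l1_bound s F a" "l1_bound s G b" "s > 0"
  shows "l1_bound s (F * G) (a * b)"
  unfolding l1_bound_def
proof
  fix n
  let ?f = "\<lambda>k. norm (fps_nth F k) * s ^ k" and ?g = "\<lambda>k. norm (fps_nth G k) * s ^ k"
  have nn: "?f k \<ge> 0" "?g k \<ge> 0" for k using assms(3) by auto
  have a: "a \<ge> 0" using assms(1) unfolding l1_bound_def by (metis lessThan_0 sum.empty)
  have "(\<Sum>j<n. norm (fps_nth (F * G) j) * s ^ j) \<le> (\<Sum>j<n. \<Sum>k\<le>j. ?f k * ?g (j - k))"
  proof (rule sum_mono)
    fix j
    have "norm (fps_nth (F * G) j) * s ^ j \<le> (\<Sum>k\<le>j. norm (fps_nth F k * fps_nth G (j - k))) * s ^ j"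
      unfolding fps_mult_nth atLeast0AtMost using assms(3) by (intro mult_right_mono norm_sum) auto
    also have "\<dots> = (\<Sum>k\<le>j. ?f k * ?g (j - k))"
      unfolding sum_distrib_right
    proof (rule sum.cong)
      fix k assume "k \<in> {..j}"
      hence "s ^ j = s ^ k * s ^ (j - k)" by (simp flip: power_add)
      thus "norm (fps_nth F k * fps_nth G (j - k)) * s ^ j = ?f k * ?g (j - k)"
        by (simp add: norm_mult)
    qed simp
    finally show "norm (fps_nth (F * G) j) * s ^ j \<le> (\<Sum>k\<le>j. ?f k * ?g (j - k))" .
  qed
  also have "\<dots> = (\<Sum>(k, l)\<in>{(k, l). k + l < n}. ?f k * ?g l)"
    by (rule sum.triangle_reindex[symmetric])
  also have "\<dots> \<le> (\<Sum>(k, l)\<in>{..<n} \<times> {..<n}. ?f k * ?g l)"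
    using nn by (intro sum_mono2) (auto intro: mult_nonneg_nonneg simp del: mult_nonneg_nonneg)
  also have "\<dots> = (\<Sum>k<n. ?f k) * (\<Sum>l<n. ?g l)"
    by (simp add: sum_product sum.cartesian_product)
  also have "\<dots> \<le> a * b"
    using assms a unfolding l1_bound_def by (intro mult_mono) (auto intro: sum_nonneg)
  finally show "(\<Sum>j<n. norm (fps_nth (F * G) j) * s ^ j) \<le> a * b" .
qed

lemma l1_bound_shift:
  assumes "l1_bound s F a" "s > 0"
  shows "l1_bound s (fps_shift d F) (a / s ^ d)"
  unfolding l1_bound_def
proof
  fix n
  have "(\<Sum>j<n. norm (fps_nth (fps_shift d F) j) * s ^ j) * s ^ d
      = (\<Sum>j<n. norm (fps_nth F (j + d)) * s ^ (j + d))"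
    by (simp add: sum_distrib_right power_add mult.assoc)
  also have "\<dots> = (\<Sum>j\<in>(\<lambda>j. j + d) ` {..<n}. norm (fps_nth F j) * s ^ j)"
    by (subst sum.reindex) auto
  also have "\<dots> \<le> (\<Sum>j<n + d. norm (fps_nth F j) * s ^ j)"
    using assms(2) by (intro sum_mono2) auto
  also have "\<dots> \<le> a" using assms(1) unfolding l1_bound_def by blast
  finally show "(\<Sum>j<n. norm (fps_nth (fps_shift d F) j) * s ^ j) \<le> a / s ^ d"
    using assms(2) by (simp add: pos_le_divide_eq)
qed

lemma l1_bound_coeff:
  assumes "l1_bound s F a" "s > 0"
  shows "norm (fps_nth F i) \<le> a * (1 / s) ^ i"
proof -
  have "norm (fps_nth F i) * s ^ i \<le> (\<Sum>j<Suc i. norm (fps_nth F j) * s ^ j)"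
    using assms(2) by (intro member_le_sum) auto
  also have "\<dots> \<le> a" using assms(1) unfolding l1_bound_def by blast
  finally show ?thesis using assms(2) by (simp add: power_divide pos_le_divide_eq)
qed

lemma l1_bound_geometric:
  assumes "\<And>i. norm (fps_nth F i) \<le> C * R ^ i" "s > 0" "R > 0" "C \<ge> 0" "s * R \<le> 1 / 2"
  shows "l1_bound s F (2 * C)"
  unfolding l1_bound_def
proof
  fix n
  have "(\<Sum>j<n. norm (fps_nth F j) * s ^ j) \<le> (\<Sum>j<n. C * (1/2) ^ j)"
  proof (rule sum_mono)
    fix j
    have "norm (fps_nth F j) * s ^ j \<le> C * R ^ j * s ^ j"
      using assms by (intro mult_right_mono) auto
    also have "\<dots> = C * (s * R) ^ j" by (simp add: power_mult_distrib mult_ac)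
    also have "\<dots> \<le> C * (1/2) ^ j" using assms by (intro mult_left_mono power_mono) auto
    finally show "norm (fps_nth F j) * s ^ j \<le> C * (1/2) ^ j" .
  qed
  also have "\<dots> \<le> (\<Sum>j. C * (1/2) ^ j)"
    using assms(4) by (intro sum_le_suminf summable_mult summable_geometric) auto
  also have "\<dots> = 2 * C" by (subst suminf_mult) (auto simp: suminf_geometric summable_geometric)
  finally show "(\<Sum>j<n. norm (fps_nth F j) * s ^ j) \<le> 2 * C" .
qed

lemma l1_bound_conv_radius:
  assumes "fps_conv_radius F > 0"
  obtains s c where "s > 0" "c \<ge> 0" "\<And>t. 0 < t \<Longrightarrow> t \<le> s \<Longrightarrow> l1_bound t F c"
proof -
  obtain s where s: "0 < ereal s" "ereal s < fps_conv_radius F" using ereal_dense2[OF assms] by blast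
  have sum: "summable (\<lambda>n. norm (fps_nth F n * of_real s ^ n))"
    using s by (intro norm_summable_fps) simp
  have "l1_bound t F (\<Sum>n. norm (fps_nth F n * of_real s ^ n))" if "0 < t" "t \<le> s" for t
    unfolding l1_bound_def
  proof
    fix n
    have "(\<Sum>j<n. norm (fps_nth F j) * t ^ j) \<le> (\<Sum>j<n. norm (fps_nth F j * of_real s ^ j))"
      using that by (intro sum_mono) (auto simp: norm_mult norm_power intro!: mult_left_mono power_mono)
    also have "\<dots> \<le> (\<Sum>n. norm (fps_nth F n * of_real s ^ n))"
      using sum by (intro sum_le_suminf) auto
    finally show "(\<Sum>j<n. norm (fps_nth F j) * t ^ j) \<le> (\<Sum>n. norm (fps_nth F n * of_real s ^ n))" .
  qed
  moreover have "(\<Sum>n. norm (fps_nth F n * of_real s ^ n)) \<ge> 0" using sum by (intro suminf_nonneg) auto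
  ultimately show ?thesis using that[of s] s by simp
qed

text \<open>The quotient is found order by order in \<open>y\<close>: in order \<open>n\<close> one divides by \<open>A\<^sub>0 = x\<^sup>d / v\<close>.\<close>

fun division_quotient ::
  "nat \<Rightarrow> complex fps \<Rightarrow> (nat \<Rightarrow> complex fps) \<Rightarrow> (nat \<Rightarrow> complex fps) \<Rightarrow> nat \<Rightarrow> complex fps" where
  "division_quotient d v A G n =
     v * fps_shift d (G n - (\<Sum>k<n. division_quotient d v A G k * A (n - k)))"

declare division_quotient.simps [simp del]

text \<open>The bounds obey a_n = D R^n + D (sum over k < n of a_k R^(n - k)), where
  \<open>D\<close> collects the costs of multiplying by \<open>v\<close>, of a coefficient of
  \<open>A\<close> or \<open>G\<close>, and of the shift by \<open>d\<close>. As D times the sum of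
  (D + 1)^k over k < n is (D + 1)^n - 1, the claimed a_n solves this recursion exactly.\<close>

lemma l1_bound_division_quotient:
  fixes d :: nat and s V C R :: real
  assumes "l1_bound s v V" "\<And>k. l1_bound s (A k) (C * R ^ k)" "\<And>k. l1_bound s (G k) (C * R ^ k)" "s > 0"
  defines "D \<equiv> V * C / s ^ d"
  shows "l1_bound s (division_quotient d v A G n) (D * ((D + 1) * R) ^ n)"
proof (induction n rule: less_induct)
  case (less n)
  let ?q = "division_quotient d v A G"
  have "l1_bound s (?q n)
    (V * ((C * R ^ n + (\<Sum>k<n. D * ((D + 1) * R) ^ k * (C * R ^ (n - k)))) / s ^ d))"
    by (subst division_quotient.simps)
       (intro l1_bound_mult l1_bound_shift l1_bound_diff l1_bound_sum assms less; simp)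
  moreover have "(\<Sum>k<n. D * ((D + 1) * R) ^ k * (C * R ^ (n - k))) = C * R ^ n * (D * (\<Sum>k<n. (D + 1) ^ k))"
    unfolding sum_distrib_left
  proof (rule sum.cong)
    fix k assume "k \<in> {..<n}"
    hence "R ^ n = R ^ k * R ^ (n - k)" by (simp flip: power_add)
    thus "D * ((D + 1) * R) ^ k * (C * R ^ (n - k)) = C * R ^ n * (D * (D + 1) ^ k)"
      by (simp add: power_mult_distrib)
  qed simp
  moreover have "D * (\<Sum>k<n. (D + 1) ^ k) = (D + 1) ^ n - 1"
    using power_diff_1_eq[of "D + 1" n] by simp
  ultimately have "l1_bound s (?q n) (V * ((C * R ^ n + C * R ^ n * ((D + 1) ^ n - 1)) / s ^ d))"
    by simp
  also have "V * ((C * R ^ n + C * R ^ n * ((D + 1) ^ n - 1)) / s ^ d) = D * ((D + 1) * R) ^ n"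
  proof -
    have "C * R ^ n + C * R ^ n * ((D + 1) ^ n - 1) = C * R ^ n * (D + 1) ^ n"
      by (simp add: right_diff_distrib)
    moreover have "V * (C * R ^ n * (D + 1) ^ n / s ^ d) = (V * C / s ^ d) * ((D + 1) * R) ^ n"
      by (simp add: power_mult_distrib)
    ultimately show ?thesis unfolding D_def by simp
  qed
  finally show ?case .
qed

text \<open>By hypothesis A(x, 0) is e x^d with a unit e. The recursion clears every order in y down
  to x-degree below \<open>d\<close>; the substance is that the quotient obtained in this way
  converges.\<close>

lemma weierstrass_division:
  fixes A G :: O2
  assumes "fps_nth (fps_of_O2 A) 0 \<noteq> 0"
  defines "d \<equiv> subdegree (fps_nth (fps_of_O2 A) 0)"
  obtains Q R where "G = Q * A + R" "\<And>i j. i \<ge> d \<Longrightarrow> O2_coeff R i j = 0"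
proof -
  let ?A = "fps_nth (fps_of_O2 A)" and ?G = "fps_nth (fps_of_O2 G)"
  define e where "e = fps_shift d (?A 0)"
  define v where "v = inverse e"
  have e0: "fps_nth e 0 \<noteq> 0" using assms by (simp add: e_def d_def)
  have ve: "v * e = 1" unfolding v_def using e0 by (rule inverse_mult_eq_1)
  have A0: "?A 0 = e * fps_X ^ d"
    unfolding e_def d_def using subdegree_decompose by blast
  obtain C R where CR: "C > 0" "R > 0" "\<And>i j. norm (fps_nth (?A j) i) \<le> C * R ^ (i + j)"
    using fps_of_O2[of A] unfolding mem_Collect_eq convergent_fps2_iff_bound by blast
  obtain C' R' where CR': "C' > 0" "R' > 0" "\<And>i j. norm (fps_nth (?G j) i) \<le> C' * R' ^ (i + j)"
    using fps_of_O2[of G] unfolding mem_Collect_eq convergent_fps2_iff_bound by blast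
  have "summable (\<lambda>i. fps_nth (?A 0) i * of_real (1 / (2 * R)) ^ i)"
  proof (rule summable_comparison_test)
    have "norm (fps_nth (?A 0) i * of_real (1 / (2 * R)) ^ i) \<le> C * (1/2) ^ i" for i
    proof -
      have "norm (fps_nth (?A 0) i * of_real (1 / (2 * R)) ^ i) \<le> (C * R ^ (i + 0)) * (1 / (2 * R)) ^ i"
        unfolding norm_mult norm_power using CR by (intro mult_mono CR(3)) (auto simp: norm_divide)
      also have "\<dots> = C * (R * (1 / (2 * R))) ^ i" unfolding power_mult_distrib by simp
      also have "R * (1 / (2 * R)) = 1 / 2" using CR by simp
      finally show ?thesis .
    qed
    thus "\<exists>N. \<forall>n\<ge>N. norm (fps_nth (?A 0) n * of_real (1 / (2 * R)) ^ n) \<le> C * (1/2) ^ n"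
      by (intro exI allI impI)
    show "summable (\<lambda>n. C * (1/2) ^ n)" by (intro summable_mult summable_geometric) simp
  qed
  from conv_radius_geI[OF this] have A0_radius: "ereal (1 / (2 * R)) \<le> fps_conv_radius (?A 0)"
    using CR(2) by (simp add: fps_conv_radius_def norm_divide)
  have "0 < ereal (1 / (2 * R))" using CR(2) by simp
  also note A0_radius
  also have "fps_conv_radius (?A 0) = fps_conv_radius e" by (simp add: e_def)
  finally have "fps_conv_radius e > 0" .
  hence "fps_conv_radius v > 0" unfolding v_def using e0 by (intro fps_conv_radius_inverse_pos) auto
  then obtain s0 V where s0: "s0 > 0" "V \<ge> 0" "\<And>t. 0 < t \<Longrightarrow> t \<le> s0 \<Longrightarrow> l1_bound t v V"
    by (rule l1_bound_conv_radius) blast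

  define M where "M = max R R'"
  define c where "c = max C C'"
  have M: "M > 0" "c > 0" using CR CR' by (auto simp: M_def c_def)
  \<comment> \<open>Small enough for \<open>v\<close> to have norm at most \<open>V\<close> and for
    s M <= 1/2, so that order k in y of \<open>A\<close> and \<open>G\<close> has norm at most 2 c
    M^k.\<close>
  define s where "s = min s0 (1 / (2 * M))"
  have s: "s > 0" "s \<le> s0" using s0 M by (auto simp: s_def)
  have "s * M \<le> 1 / (2 * M) * M" using M by (intro mult_right_mono) (auto simp: s_def)
  hence sM: "s * M \<le> 1 / 2" using M by simp
  have bA: "l1_bound s (?A k) ((2 * c) * M ^ k)" for k
  proof -
    have "norm (fps_nth (?A k) i) \<le> c * M ^ k * M ^ i" for i
    proof -
      have "C * R ^ (i + k) \<le> c * M ^ (i + k)"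
        using CR by (intro mult_mono power_mono) (auto simp: c_def M_def)
      thus ?thesis using CR(3)[of k i] by (simp add: power_add mult_ac)
    qed
    from l1_bound_geometric[OF this s(1) M(1) _ sM] show ?thesis using M by (simp add: mult.assoc)
  qed
  have bG: "l1_bound s (?G k) ((2 * c) * M ^ k)" for k
  proof -
    have "norm (fps_nth (?G k) i) \<le> c * M ^ k * M ^ i" for i
    proof -
      have "C' * R' ^ (i + k) \<le> c * M ^ (i + k)"
        using CR' by (intro mult_mono power_mono) (auto simp: c_def M_def)
      thus ?thesis using CR'(3)[of k i] by (simp add: power_add mult_ac)
    qed
    from l1_bound_geometric[OF this s(1) M(1) _ sM] show ?thesis using M by (simp add: mult.assoc)
  qed
  define D where "D = V * (2 * c) / s ^ d"
  define q where "q = division_quotient d v ?A ?G"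
  have D: "D \<ge> 0" using s0 M s by (simp add: D_def)
  have bq: "l1_bound s (q n) (D * ((D + 1) * M) ^ n)" for n
    unfolding q_def D_def by (rule l1_bound_division_quotient[OF s0(3)[OF s] bA bG s(1)])
  \<comment> \<open>Growth is (D + 1) M per degree in y and 1/s per degree in x. The constant below
    is D + 1 because \<open>D\<close> may be 0.\<close>
  define L where "L = max ((D + 1) * M) (1 / s)"
  have conv: "convergent_fps2 (Abs_fps q)"
    unfolding convergent_fps2_iff_bound
  proof (intro exI conjI allI)
    show "D + 1 > 0" "L > 0" using D s by (auto simp: L_def less_max_iff_disj)
    fix i j
    have "norm (fps_nth (fps_nth (Abs_fps q) j) i) \<le> D * ((D + 1) * M) ^ j * (1 / s) ^ i"
      using l1_bound_coeff[OF bq s(1)] by simp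
    also have "\<dots> \<le> (D + 1) * L ^ j * L ^ i"
      using D M s by (intro mult_mono power_mono mult_nonneg_nonneg zero_le_power) (auto simp: L_def le_max_iff_disj)
    finally show "norm (fps_nth (fps_nth (Abs_fps q) j) i) \<le> (D + 1) * L ^ (i + j)"
      by (simp add: power_add mult_ac)
  qed
  define Q where "Q = Abs_O2 (Abs_fps q)"
  have Q: "fps_of_O2 Q = Abs_fps q" unfolding Q_def using conv by (simp add: Abs_O2_inverse)
  define S where "S = G - Q * A"
  have "O2_coeff S i n = 0" if i: "i \<ge> d" for i n
  proof -
    define H where "H = ?G n - (\<Sum>k<n. q k * ?A (n - k))"
    have qn: "q n = v * fps_shift d H"
      unfolding H_def q_def by (rule division_quotient.simps)
    have "fps_nth (fps_of_O2 S) n = ?G n - (\<Sum>k=0..n. q k * ?A (n - k))"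
      by (simp add: S_def minus_O2.rep_eq times_O2.rep_eq Q fps_mult_nth)
    also have "(\<Sum>k=0..n. q k * ?A (n - k)) = (\<Sum>k<n. q k * ?A (n - k)) + q n * ?A 0"
      by (simp add: atLeast0AtMost flip: lessThan_Suc_atMost)
    \<comment> \<open>As v e = 1, the newest summand removes exactly the part of \<open>H\<close> of
      degree at least \<open>d\<close>.\<close>
    also have "q n * ?A 0 = (v * e) * (fps_shift d H * fps_X ^ d)"
      unfolding qn A0 by (simp add: mult_ac)
    also have "\<dots> = fps_shift d H * fps_X ^ d" unfolding ve by simp
    also have "?G n - ((\<Sum>k<n. q k * ?A (n - k)) + fps_shift d H * fps_X ^ d) = H - fps_shift d H * fps_X ^ d"
      by (simp add: H_def)
    finally show ?thesis using i by (simp add: O2_coeff_def fps_X_power_mult_right_nth)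
  qed
  thus ?thesis using that[of Q S] by (simp add: S_def)
qed

section \<open>Isolated common zeros\<close>

text \<open>Power series in y alone, kept inside \<open>O2\<close> so that determinants over them
  live in the same ring as \<open>A\<close>, \<open>B\<close> and x.\<close>

definition y_only :: "O2 \<Rightarrow> bool" where
  "y_only F \<longleftrightarrow> (\<forall>i>0. \<forall>j. O2_coeff F i j = 0)"

lemma O2_coeff_mult:
  "O2_coeff (F * G) i j = (\<Sum>l=0..j. \<Sum>k=0..i. O2_coeff F k l * O2_coeff G (i - k) (j - l))"
  by (simp add: O2_coeff_def times_O2.rep_eq fps_mult_nth fps_sum_nth)

lemma y_only_mult: "y_only F \<Longrightarrow> y_only G \<Longrightarrow> y_only (F * G)"
  unfolding y_only_def O2_coeff_mult
proof (intro allI impI sum.neutral ballI)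
  fix i j l k assume "\<forall>i>0. \<forall>j. O2_coeff F i j = 0" "\<forall>i>0. \<forall>j. O2_coeff G i j = 0"
    and "(0 :: nat) < i" "k \<in> {0..i}"
  thus "O2_coeff F k l * O2_coeff G (i - k) (j - l) = 0" by (cases "k = 0") auto
qed

lemma y_only_sum: "(\<And>t. t \<in> T \<Longrightarrow> y_only (F t)) \<Longrightarrow> y_only (\<Sum>t\<in>T. F t)"
  by (simp add: y_only_def)

lemma y_only_const: "y_only (O2_const c)"
  by (simp add: y_only_def O2_coeff_def O2_const.rep_eq)

lemma y_only_prod: "(\<And>t. t \<in> T \<Longrightarrow> y_only (F t)) \<Longrightarrow> y_only (\<Prod>t\<in>T. F t)"
proof (induction T rule: infinite_finite_induct)
  case (insert t T)
  thus ?case by (simp add: y_only_mult)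
qed (use y_only_const[of 1] in \<open>simp_all add: O2_const_simps\<close>)

lemma O2_const_sign: "O2_const (of_int (sign p)) = of_int (sign p)"
  by (simp add: sign_def O2_const_simps)

lemma y_only_det:
  assumes "\<And>i k. i < d \<Longrightarrow> k < d \<Longrightarrow> y_only (M i k)"
  shows "y_only (det (mat d d (\<lambda>(i, k). M i k)))"
proof -
  have "y_only (of_int (sign p) * (\<Prod>i=0..<d. M i (p i)))" if "p permutes {0..<d}" for p
    using that by (intro y_only_mult y_only_prod assms)
      (auto simp: permutes_in_image dest: permutes_nat_less simp flip: O2_const_sign intro: y_only_const)
  moreover have "det (mat d d (\<lambda>(i, k). M i k))
      = (\<Sum>p | p permutes {0..<d}. of_int (sign p) * (\<Prod>i=0..<d. M i (p i)))"
    unfolding det_def by (auto intro!: sum.cong prod.cong arg_cong2[of _ _ _ _ "(*)"] simp: permutes_in_image)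
  ultimately show ?thesis by (auto intro: y_only_sum)
qed

lemma eventually_O2_eval_det:
  "\<forall>\<^sub>F z in nhds (0, 0). O2_eval (det (mat d d (\<lambda>(i, k). M i k))) z
     = det (mat d d (\<lambda>(i, k). O2_eval (M i k) z))"
proof -
  let ?S = "{p. p permutes {0..<d}}"
  have det: "det (mat d d (\<lambda>(i, k). N i k)) = (\<Sum>p\<in>?S. of_int (sign p) * (\<Prod>i=0..<d. N i (p i)))"
    for N :: "nat \<Rightarrow> nat \<Rightarrow> 'c :: comm_ring_1"
    unfolding det_def by (auto intro!: sum.cong prod.cong arg_cong2[of _ _ _ _ "(*)"] simp: permutes_in_image)
  have fin: "finite ?S" by (simp add: finite_permutations)
  have "\<forall>\<^sub>F z in nhds (0, 0). \<forall>p\<in>?S. O2_eval (of_int (sign p) * (\<Prod>i=0..<d. M i (p i))) z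
      = of_int (sign p) * (\<Prod>i=0..<d. O2_eval (M i (p i)) z)"
  proof (rule eventually_ball_finite[OF fin], rule ballI)
    fix p :: "nat \<Rightarrow> nat"
    have c: "O2_eval (of_int (sign p)) z = of_int (sign p)" for z
      using O2_eval_simps(2)[of "of_int (sign p)" z] by (simp add: O2_const_sign)
    from eventually_O2_eval_mult[of "of_int (sign p)" "\<Prod>i=0..<d. M i (p i)"]
      eventually_O2_eval_prod[of "{0..<d}" "\<lambda>i. M i (p i)", simplified]
    show "\<forall>\<^sub>F z in nhds (0, 0). O2_eval (of_int (sign p) * (\<Prod>i=0..<d. M i (p i))) z
      = of_int (sign p) * (\<Prod>i=0..<d. O2_eval (M i (p i)) z)"
      by eventually_elim (simp add: c)
  qed
  with eventually_O2_eval_sum[OF fin, of "\<lambda>p. of_int (sign p) * (\<Prod>i=0..<d. M i (p i))"]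
  show ?thesis unfolding det by eventually_elim simp
qed

lemma O2_eval_y_only:
  assumes "y_only F"
  shows "O2_eval F (x, y) = O2_eval F (0, y)"
proof -
  have "O2_coeff F i j * x ^ i * y ^ j = O2_coeff F i j * 0 ^ i * y ^ j" for i j
    using assms by (cases "i = 0") (auto simp: y_only_def)
  thus ?thesis unfolding O2_eval_def prod.case by (simp only:)
qed

lemma O2_y_power_in_ideal:
  assumes "y_only \<rho>" "\<rho> \<noteq> 0"
  obtains k where "O2_y ^ k \<in> idl {\<rho>}"
proof -
  have ex: "\<exists>j. O2_coeff \<rho> 0 j \<noteq> 0"
  proof (rule ccontr)
    assume "\<not> ?thesis"
    hence "O2_coeff \<rho> i j = O2_coeff 0 i j" for i j
      using assms(1) by (cases "i = 0") (auto simp: y_only_def)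
    thus False using assms(2) O2_eqI by blast
  qed
  define k where "k = (LEAST j. O2_coeff \<rho> 0 j \<noteq> 0)"
  have k: "O2_coeff \<rho> 0 k \<noteq> 0" unfolding k_def using ex by (rule LeastI_ex)
  have k': "O2_coeff \<rho> 0 j = 0" if "j < k" for j
    using not_less_Least that unfolding k_def by blast
  define v where "v = O2_shift_y k \<rho>"
  have "\<rho> = O2_y ^ k * v"
  proof (rule O2_eqI)
    fix i j
    show "O2_coeff \<rho> i j = O2_coeff (O2_y ^ k * v) i j"
      using assms(1) k' by (cases "i = 0") (auto simp: v_def y_only_def)
  qed
  have "fps_nth (fps_nth (fps_of_O2 v) 0) 0 = O2_coeff \<rho> 0 k"
    using O2_coeff_simps(9)[of k \<rho> 0 0] unfolding v_def O2_coeff_def by simp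
  hence v0: "fps_nth (fps_nth (fps_of_O2 v) 0) 0 \<noteq> 0" using k by simp
  hence "fps_nth (fps_of_O2 v) 0 \<noteq> 0" "subdegree (fps_nth (fps_of_O2 v) 0) = 0"
    by auto
  \<comment> \<open>Division of 1 by \<open>v\<close> with d = 0 leaves remainder 0 and so inverts
    \<open>v\<close>, convergence included.\<close>
  then obtain Q R where QR: "1 = Q * v + R" "\<And>i j. O2_coeff R i j = 0"
    using weierstrass_division[of v 1] by auto
  have "R = 0" by (rule O2_eqI) (simp add: QR(2))
  hence "O2_y ^ k = Q * \<rho>" using QR(1) \<open>\<rho> = O2_y ^ k * v\<close> by (metis add.right_neutral mult.left_commute mult.right_neutral)
  hence "O2_y ^ k \<in> idl {\<rho>}" by (simp add: idl_mult idl_inc)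
  thus ?thesis using that by blast
qed

text \<open>The coefficient of x^k as a series in y: the grouping opposite to the representation,
  and the one in which remainders of the division are polynomials in x.\<close>

definition x_column :: "nat \<Rightarrow> O2 \<Rightarrow> O2" where
  "x_column k F = O2_cutoff_x 1 (O2_shift_x k F)"

lemma O2_coeff_x_column: "O2_coeff (x_column k F) i j = (if i = 0 then O2_coeff F k j else 0)"
  by (simp add: x_column_def)

lemma y_only_x_column: "y_only (x_column k F)"
  by (simp add: y_only_def O2_coeff_x_column)

lemma x_polynomial_expand:
  assumes "\<And>i j. i \<ge> d \<Longrightarrow> O2_coeff F i j = 0"
  shows "F = (\<Sum>k<d. O2_x ^ k * x_column k F)"
proof (rule O2_eqI)
  fix i j
  have "O2_coeff (\<Sum>k<d. O2_x ^ k * x_column k F) i j = (\<Sum>k<d. if k = i then O2_coeff F i j else 0)"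
    unfolding O2_coeff_sum by (intro sum.cong) (auto simp: O2_coeff_x_column)
  also have "\<dots> = O2_coeff F i j" using assms by (auto simp: not_less)
  finally show "O2_coeff F i j = O2_coeff (\<Sum>k<d. O2_x ^ k * x_column k F) i j" ..
qed

text \<open>Roots of \<open>p\<close> are removed one by one, with multiplicity. At a root a, H(a)
  nonzero forces u(a) = 0, and x - a is cancelled on both sides; the cancelled identity holds at
  first away from a and extends to a by continuity.\<close>

lemma poly_dvd_of_local_identity:
  fixes p u :: "complex poly" and S H :: "complex \<Rightarrow> complex"
  assumes "p \<noteq> 0" "\<And>x. poly p x = 0 \<Longrightarrow> norm x < \<delta> \<and> H x \<noteq> 0"
    and "\<And>x. norm x < \<delta> \<Longrightarrow> isCont S x \<and> isCont H x"
    and "\<And>x. norm x < \<delta> \<Longrightarrow> poly p x * S x = poly u x * H x"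
  shows "p dvd u"
  using assms(1,2,4)
proof (induction "Polynomial.degree p" arbitrary: p u)
  case 0
  thus ?case by (metis is_unit_iff_degree unit_imp_dvd)
next
  case (Suc n)
  have "\<not> constant (poly p)" using Suc(2) by (simp add: constant_degree)
  then obtain a where a: "poly p a = 0" using fundamental_theorem_of_algebra by blast
  then obtain p' where p': "p = [:-a, 1:] * p'" unfolding poly_eq_0_iff_dvd by (auto simp: dvd_def)
  have an: "norm a < \<delta>" "H a \<noteq> 0" using Suc(4)[OF a] by auto
  hence "poly u a = 0" using Suc(5)[of a] a by simp
  then obtain u' where u': "u = [:-a, 1:] * u'" unfolding poly_eq_0_iff_dvd by (auto simp: dvd_def)
  have p'0: "p' \<noteq> 0" using Suc(3) p' by auto
  have n: "n = Polynomial.degree p'" using Suc(2) unfolding p' by (subst (asm) degree_mult_eq) (use p'0 in auto)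
  have eq: "poly p' x * S x = poly u' x * H x" if x: "norm x < \<delta>" "x \<noteq> a" for x
  proof -
    have "(x - a) * (poly p' x * S x) = (x - a) * (poly u' x * H x)"
      using Suc(5)[OF x(1)] unfolding p' u' by (simp add: algebra_simps)
    thus ?thesis using x(2) by simp
  qed
  let ?h = "\<lambda>x. poly p' x * S x - poly u' x * H x"
  have "isCont ?h a" using assms(3)[OF an(1)] by (intro continuous_intros) auto
  hence "(?h \<longlongrightarrow> ?h a) (at a)" by (simp add: isCont_def)
  moreover have "\<forall>\<^sub>F x in at a. ?h x = 0"
  proof -
    have "\<forall>\<^sub>F x in nhds a. x \<in> ball 0 \<delta>" using an(1) by (intro eventually_nhds_in_open) auto
    hence "\<forall>\<^sub>F x in at a. x \<in> ball 0 \<delta> \<and> x \<noteq> a"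
      unfolding eventually_at_filter by eventually_elim auto
    thus ?thesis by eventually_elim (use eq in auto)
  qed
  hence "(?h \<longlongrightarrow> 0) (at a)" by (rule tendsto_eventually)
  ultimately have "?h a = 0" using tendsto_unique[OF at_neq_bot] by blast
  hence "poly p' x * S x = poly u' x * H x" if "norm x < \<delta>" for x
    using eq[OF that] by (cases "x = a") auto
  from Suc(1)[OF n p'0 _ this] have "p' dvd u'" using Suc(4) unfolding p' by simp
  thus ?case unfolding p' u' by (rule mult_dvd_mono[OF dvd_refl])
qed

text \<open>If |x| >= \<open>\<delta>\<close>, then |x|^k <= |x|^d / \<open>\<delta>\<close>^(d -
  k). With \<open>\<Sigma>\<close> the sum of these 1/\<open>\<delta>\<close>^(d - k), the equation
  would give |x|^d <= |x|^d \<open>\<Sigma>\<close> / (1 + \<open>\<Sigma>\<close>), which is less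
  than |x|^d.\<close>

lemma root_bound:
  fixes x :: complex
  assumes "\<delta> > 0" "x ^ d = (\<Sum>k<d. c k * x ^ k)"
    and "\<And>k. k < d \<Longrightarrow> norm (c k) \<le> 1 / (1 + (\<Sum>k<d. 1 / \<delta> ^ (d - k)))"
  shows "norm x < \<delta>"
proof (rule ccontr)
  assume "\<not> ?thesis"
  hence x: "norm x \<ge> \<delta>" by simp
  define \<Sigma> where "\<Sigma> = (\<Sum>k<d. 1 / \<delta> ^ (d - k))"
  have \<Sigma>: "\<Sigma> \<ge> 0" unfolding \<Sigma>_def using assms(1) by (intro sum_nonneg) auto
  have pos: "norm x ^ d > 0" using x assms(1) by (intro zero_less_power) linarith
  have "norm x ^ d = norm (\<Sum>k<d. c k * x ^ k)" using assms(2) by (metis norm_power)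
  also have "\<dots> \<le> (\<Sum>k<d. 1 / (1 + \<Sigma>) * (norm x ^ d * (1 / \<delta> ^ (d - k))))"
  proof (rule sum_norm_le)
    fix k assume k: "k \<in> {..<d}"
    have "norm x ^ k * \<delta> ^ (d - k) \<le> norm x ^ k * norm x ^ (d - k)"
      using x assms(1) by (intro mult_left_mono power_mono) auto
    also have "\<dots> = norm x ^ d" using k by (simp flip: power_add)
    finally have "norm x ^ k \<le> norm x ^ d * (1 / \<delta> ^ (d - k))"
      using assms(1) by (simp add: pos_le_divide_eq)
    thus "norm (c k * x ^ k) \<le> 1 / (1 + \<Sigma>) * (norm x ^ d * (1 / \<delta> ^ (d - k)))"
      unfolding norm_mult norm_power using assms(3)[of k] k \<Sigma>
      by (intro mult_mono) (auto simp: \<Sigma>_def)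
  qed
  also have "\<dots> = norm x ^ d * (\<Sigma> / (1 + \<Sigma>))"
    unfolding \<Sigma>_def by (simp add: sum_distrib_left sum_divide_distrib mult_ac)
  also have "\<dots> < norm x ^ d * 1"
    using pos \<Sigma> by (intro mult_strict_left_mono) auto
  finally show False by simp
qed

lemma idl_power_cong:
  assumes "u - v \<in> idl S" "v ^ n \<in> idl S"
  shows "u ^ n \<in> idl S"
proof -
  have "u ^ m - v ^ m \<in> idl S" for m
  proof (induction m)
    case (Suc m)
    have "u ^ Suc m - v ^ Suc m = u * (u ^ m - v ^ m) + v ^ m * (u - v)" by (simp add: algebra_simps)
    thus ?case using Suc assms(1) by (simp add: idl_add idl_mult)
  qed (simp add: idl_zero)
  hence "(u ^ n - v ^ n) + v ^ n \<in> idl S" using assms(2) by (rule idl_add)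
  thus ?thesis by simp
qed


text \<open>Weierstrass division makes \<open>O2/(A)\<close> a module over the series in \<open>y\<close> spanned by
  \<open>1, x, \<dots>, x\<^sup>d\<^sup>-\<^sup>1\<close>; \<open>M\<close> is the matrix of multiplication by \<open>B\<close> and \<open>\<rho>\<close> its determinant, which lies
  in \<open>(A, B)\<close>. If \<open>\<rho> \<noteq> 0\<close>, a power of \<open>y\<close> is in the ideal. If \<open>\<rho> = 0\<close>, then for a fixed small \<open>y\<^sub>0 \<noteq> 0\<close>
  a kernel vector gives a polynomial \<open>u \<noteq> 0\<close> of degree less than \<open>d\<close> such that the Weierstrass
  polynomial \<open>p\<close> of \<open>A(\<cdot>, y\<^sub>0)\<close> divides \<open>u B\<close>; as \<open>B \<noteq> 0\<close> at the zeros of \<open>p\<close>, it divides \<open>u\<close>, which is absurd.\<close>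

lemma isolated_common_zero_mprimary_aux:
  assumes iso: "\<forall>\<^sub>F z in at (0, 0). \<not> (O2_eval A z = 0 \<and> O2_eval B z = 0)"
    and A: "fps_nth (fps_of_O2 A) 0 \<noteq> 0"
  shows "mprimary {A, B}"
proof -
  define d where "d = subdegree (fps_nth (fps_of_O2 A) 0)"
  have "\<forall>G. \<exists>Q R. G = Q * A + R \<and> (\<forall>i j. i \<ge> d \<longrightarrow> O2_coeff R i j = 0)"
    using weierstrass_division[OF A] unfolding d_def by metis
  then obtain quo rem where div: "\<And>G. G = quo G * A + rem G"
    "\<And>G i j. i \<ge> d \<Longrightarrow> O2_coeff (rem G) i j = 0" by metis
  have expand: "rem G = (\<Sum>k<d. O2_x ^ k * x_column k (rem G))" for G
    by (rule x_polynomial_expand) (rule div(2))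

  define Q where "Q = quo (O2_x ^ d)"
  define T where "T = rem (O2_x ^ d)"
  define w where "w = (\<lambda>k. x_column k T)"
  have W: "O2_x ^ d = Q * A + T" using div(1)[of "O2_x ^ d"] by (simp add: Q_def T_def)
  have T: "T = (\<Sum>k<d. O2_x ^ k * w k)" unfolding w_def T_def by (rule expand)
  have AX: "fps_nth (fps_of_O2 A) 0 = fps_shift d (fps_nth (fps_of_O2 A) 0) * fps_X ^ d"
    unfolding d_def by (rule subdegree_decompose)
  have X: "fps_of_O2 (O2_x ^ d) = fps_const (fps_X ^ d)"
    by (induction d) (simp_all add: one_O2.rep_eq times_O2.rep_eq O2_x.rep_eq fps_const_mult)
  define e where "e = fps_shift d (fps_nth (fps_of_O2 A) 0)"
  \<comment> \<open>Putting y = 0: \<open>T\<close> becomes a multiple of x^d of degree below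
    \<open>d\<close>, hence 0, and \<open>Q\<close> is a unit. So every \<open>w k\<close> vanishes
    at the origin and x^d - T is the Weierstrass polynomial of \<open>A\<close>.\<close>
  have "fps_X ^ d = fps_nth (fps_of_O2 Q) 0 * (e * fps_X ^ d) + fps_nth (fps_of_O2 T) 0"
    using arg_cong[OF W, of "\<lambda>F. fps_nth (fps_of_O2 F) 0"] AX
    by (simp add: X plus_O2.rep_eq times_O2.rep_eq e_def)
  hence eq: "fps_nth (fps_of_O2 T) 0 = (1 - fps_nth (fps_of_O2 Q) 0 * e) * fps_X ^ d"
    by (simp add: algebra_simps)
  have T0: "O2_coeff T i 0 = 0" for i
  proof (cases "i < d")
    case True
    thus ?thesis unfolding O2_coeff_def eq by (simp add: fps_X_power_mult_right_nth)
  next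
    case False
    thus ?thesis unfolding T_def by (intro div(2)) simp
  qed
  hence "fps_nth (fps_of_O2 T) 0 = 0" by (simp add: fps_eq_iff O2_coeff_def)
  hence "fps_nth (fps_of_O2 Q) 0 * e = 1" using eq by simp
  hence "fps_nth (fps_nth (fps_of_O2 Q) 0) 0 * fps_nth e 0 = 1" by (metis fps_mult_nth_0 fps_one_nth)
  hence Q0: "O2_coeff Q 0 0 \<noteq> 0" by (auto simp: O2_coeff_def)
  have w0: "O2_coeff (w k) 0 0 = 0" for k by (simp add: w_def O2_coeff_x_column T0)
  have yw: "y_only (w k)" for k by (simp add: w_def y_only_x_column)

  define S where "S = (\<lambda>i. quo (O2_x ^ i * B))"
  define M where "M = (\<lambda>i k. x_column k (rem (O2_x ^ i * B)))"
  have XB: "O2_x ^ i * B = S i * A + (\<Sum>k<d. O2_x ^ k * M i k)" for i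
    using div(1)[of "O2_x ^ i * B"] expand[of "O2_x ^ i * B"] by (simp add: S_def M_def)
  have yM: "y_only (M i k)" for i k by (simp add: M_def y_only_x_column)
  define \<rho> where "\<rho> = det (mat d d (\<lambda>(i, k). M i k))"
  have "y_only \<rho>" unfolding \<rho>_def by (rule y_only_det) (rule yM)

  show ?thesis
  proof (cases "\<rho> = 0")
    case False
    have "\<rho> \<in> idl {A, B}"
    proof (cases "d = 0")
      \<comment> \<open>Here \<open>A\<close> is a unit, and the adjugate has no row 0.\<close>
      case True
      hence "1 = Q * A" using W T by simp
      hence "\<rho> = (\<rho> * Q) * A" by (metis mult.assoc mult.right_neutral)
      thus ?thesis by (metis idl_mult idl_inc insertI1)
    next
      case d: False
      define N where "N = mat d d (\<lambda>(i, k). M i k)"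
      have N: "N \<in> carrier_mat d d" by (simp add: N_def)
      \<comment> \<open>Row 0 of the adjugate combines the rows of \<open>M\<close> into
        (\<open>\<rho>\<close>, 0, ..., 0). Applied to the expansions of x^i B it exhibits
        \<open>\<rho>\<close> as a multiple of \<open>B\<close> modulo \<open>A\<close>.\<close>
      define a where "a = (\<lambda>i. adj_mat N $$ (0, i))"
      have adj: "(\<Sum>i<d. a i * M i k) = (if k = 0 then \<rho> else 0)" if k: "k < d" for k
      proof -
        have "(adj_mat N * N) $$ (0, k) = (\<Sum>i<d. a i * M i k)"
          using adj_mat(1)[OF N] N d k
          by (auto simp: scalar_prod_def a_def N_def atLeast0LessThan intro!: sum.cong)
        moreover have "(adj_mat N * N) $$ (0, k) = (if k = 0 then \<rho> else 0)"
          unfolding adj_mat(3)[OF N] \<rho>_def N_def[symmetric] using d k by simp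
        ultimately show ?thesis by simp
      qed
      have "(\<Sum>i<d. a i * (\<Sum>k<d. O2_x ^ k * M i k)) = (\<Sum>k<d. O2_x ^ k * (\<Sum>i<d. a i * M i k))"
        unfolding sum_distrib_left by (subst sum.swap) (simp add: mult_ac)
      also have "\<dots> = (\<Sum>k<d. if k = 0 then \<rho> else 0)"
        by (intro sum.cong) (auto simp: adj)
      also have "\<dots> = \<rho>" using d by simp
      finally have "\<rho> = (\<Sum>i<d. a i * (\<Sum>k<d. O2_x ^ k * M i k))" ..
      also have "\<dots> = (\<Sum>i<d. a i * (O2_x ^ i * B - S i * A))"
        by (simp add: XB)
      also have "\<dots> = (\<Sum>i<d. a i * O2_x ^ i) * B - (\<Sum>i<d. a i * S i) * A"
        by (simp add: sum_distrib_right right_diff_distrib sum_subtractf mult.assoc)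
      also have "\<dots> \<in> idl {A, B}" by (intro idl_diff idl_mult idl_inc) auto
      finally show ?thesis .
    qed
    moreover obtain k where "O2_y ^ k \<in> idl {\<rho>}"
      using O2_y_power_in_ideal[OF \<open>y_only \<rho>\<close> False] .
    ultimately have y: "O2_y ^ k \<in> idl {A, B}"
      using idl_le_idlI[of "{\<rho>}" "{A, B}"] by blast
    \<comment> \<open>Now T^k is divisible by y^k, and x^d is \<open>T\<close> modulo
      \<open>A\<close>, so the power of y yields a power of x.\<close>
    have "T = O2_y * O2_shift_y 1 T"
    proof (rule O2_eqI)
      fix i j
      have "O2_coeff T i j = O2_coeff (O2_y ^ 1 * O2_shift_y 1 T) i j"
        unfolding O2_coeff_simps using T0 by (cases j) simp_all
      thus "O2_coeff T i j = O2_coeff (O2_y * O2_shift_y 1 T) i j" by simp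
    qed
    hence "T ^ k = O2_y ^ k * O2_shift_y 1 T ^ k" by (metis power_mult_distrib)
    hence "T ^ k \<in> idl {A, B}" using y by (simp add: idl_mult_right)
    moreover have "O2_x ^ d - T \<in> idl {A, B}" unfolding W by (simp add: idl_mult idl_inc)
    ultimately have "(O2_x ^ d) ^ k \<in> idl {A, B}" by (rule idl_power_cong[rotated])
    thus ?thesis using y by (intro mprimaryI[of "d * k" _ k]) (simp_all add: power_mult)
  next
    case True
    have E1: "\<forall>\<^sub>F z in nhds (0, 0). \<forall>i\<in>{..<d}. fst z ^ i * O2_eval B z
        = O2_eval (S i) z * O2_eval A z + (\<Sum>k<d. fst z ^ k * O2_eval (M i k) z)"
    proof (rule eventually_ball_finite, simp, rule ballI)
      fix i
      have M: "\<forall>\<^sub>F z in nhds (0, 0). \<forall>k\<in>{..<d}. O2_eval (O2_x ^ k * M i k) z = O2_eval (O2_x ^ k) z * O2_eval (M i k) z"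
        by (rule eventually_ball_finite) (auto intro: eventually_O2_eval_mult)
      have P: "\<forall>\<^sub>F z in nhds (0, 0). \<forall>k\<in>{..<d}. O2_eval (O2_x ^ k) z = O2_eval O2_x z ^ k"
        by (rule eventually_ball_finite) (auto intro: eventually_O2_eval_power)
      from eventually_O2_eval_mult[of "O2_x ^ i" B] eventually_O2_eval_power[of O2_x i]
        eventually_O2_eval_add[of "S i * A" "\<Sum>k<d. O2_x ^ k * M i k"]
        eventually_O2_eval_mult[of "S i" A]
        eventually_O2_eval_sum[of "{..<d}" "\<lambda>k. O2_x ^ k * M i k", OF finite_lessThan] M P
      show "\<forall>\<^sub>F z in nhds (0, 0). fst z ^ i * O2_eval B z
        = O2_eval (S i) z * O2_eval A z + (\<Sum>k<d. fst z ^ k * O2_eval (M i k) z)"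
        by eventually_elim (simp add: XB[symmetric] O2_eval_simps)
    qed
    have E2: "\<forall>\<^sub>F z in nhds (0, 0). fst z ^ d
        = O2_eval Q z * O2_eval A z + (\<Sum>k<d. O2_eval (w k) z * fst z ^ k)"
    proof -
      have M: "\<forall>\<^sub>F z in nhds (0, 0). \<forall>k\<in>{..<d}. O2_eval (O2_x ^ k * w k) z = O2_eval (O2_x ^ k) z * O2_eval (w k) z"
        by (rule eventually_ball_finite) (auto intro: eventually_O2_eval_mult)
      have P: "\<forall>\<^sub>F z in nhds (0, 0). \<forall>k\<in>{..<d}. O2_eval (O2_x ^ k) z = O2_eval O2_x z ^ k"
        by (rule eventually_ball_finite) (auto intro: eventually_O2_eval_power)
      have W': "O2_x ^ d = Q * A + (\<Sum>k<d. O2_x ^ k * w k)" using W T by simp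
      from eventually_O2_eval_power[of O2_x d]
        eventually_O2_eval_add[of "Q * A" "\<Sum>k<d. O2_x ^ k * w k"]
        eventually_O2_eval_mult[of Q A]
        eventually_O2_eval_sum[of "{..<d}" "\<lambda>k. O2_x ^ k * w k", OF finite_lessThan] M P
      have "\<forall>\<^sub>F z in nhds (0, 0). fst z ^ d
        = O2_eval Q z * O2_eval A z + (\<Sum>k<d. fst z ^ k * O2_eval (w k) z)"
        by eventually_elim (simp add: W'[symmetric] O2_eval_simps)
      thus ?thesis by (simp only: mult.commute)
    qed
    have E3: "\<forall>\<^sub>F z in nhds (0, 0). det (mat d d (\<lambda>(i, k). O2_eval (M i k) z)) = 0"
      using eventually_O2_eval_det[of d M]
      by eventually_elim (use True in \<open>simp add: \<rho>_def O2_eval_simps\<close>)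
    have cont0: "(O2_eval F \<longlongrightarrow> O2_coeff F 0 0) (nhds (0, 0))" for F
      using eventually_nhds_x_imp_x[OF eventually_isCont_O2_eval[of F]]
      unfolding isCont_def tendsto_at_iff_tendsto_nhds unfolding O2_eval_origin .
    have E4: "\<forall>\<^sub>F z in nhds (0, 0). O2_eval Q z \<noteq> 0"
      using tendsto_imp_eventually_ne[OF cont0 Q0] .
    have E5: "\<forall>\<^sub>F z in nhds (0, 0). isCont (O2_eval B) z \<and> isCont (O2_eval Q) z
        \<and> (\<forall>i\<in>{..<d}. isCont (O2_eval (S i)) z)"
      by (intro eventually_conj eventually_ball_finite ballI eventually_isCont_O2_eval) simp
    have E6: "\<forall>\<^sub>F z in nhds (0, 0). z \<noteq> (0, 0) \<longrightarrow> \<not> (O2_eval A z = 0 \<and> O2_eval B z = 0)"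
      using iso by (simp add: eventually_at_filter)
    obtain \<delta> where \<delta>: "\<delta> > 0"
      and E: "\<And>x y. norm x < \<delta> \<Longrightarrow> norm y < \<delta> \<Longrightarrow>
        (\<forall>i\<in>{..<d}. x ^ i * O2_eval B (x, y)
          = O2_eval (S i) (x, y) * O2_eval A (x, y) + (\<Sum>k<d. x ^ k * O2_eval (M i k) (x, y))) \<and>
        x ^ d = O2_eval Q (x, y) * O2_eval A (x, y) + (\<Sum>k<d. O2_eval (w k) (x, y) * x ^ k) \<and>
        det (mat d d (\<lambda>(i, k). O2_eval (M i k) (x, y))) = 0 \<and>
        O2_eval Q (x, y) \<noteq> 0 \<and>
        (isCont (O2_eval B) (x, y) \<and> isCont (O2_eval Q) (x, y)
        \<and> (\<forall>i\<in>{..<d}. isCont (O2_eval (S i)) (x, y))) \<and>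
        ((x, y) \<noteq> (0, 0) \<longrightarrow> \<not> (O2_eval A (x, y) = 0 \<and> O2_eval B (x, y) = 0))"
      using eventually_conj[OF E1 eventually_conj[OF E2 eventually_conj[OF E3 eventually_conj[OF E4 eventually_conj[OF E5 E6]]]]]
      unfolding eventually_nhds_origin_iff fst_conv by blast
    \<comment> \<open>The threshold of \<open>root_bound\<close>: it keeps all roots in the disc of
      radius \<open>\<delta>\<close>, where the identities hold.\<close>
    define \<eta> where "\<eta> = 1 / (1 + (\<Sum>k<d. 1 / \<delta> ^ (d - k)))"
    have "(\<Sum>k<d. 1 / \<delta> ^ (d - k)) \<ge> 0" using \<delta> by (intro sum_nonneg) auto
    hence \<eta>: "\<eta> > 0" by (simp add: \<eta>_def)
    have "\<forall>\<^sub>F z in nhds (0, 0). \<forall>k\<in>{..<d}. norm (O2_eval (w k) z) < \<eta>"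
    proof (rule eventually_ball_finite, simp, rule ballI)
      fix k
      show "\<forall>\<^sub>F z in nhds (0, 0). norm (O2_eval (w k) z) < \<eta>"
        using tendstoD[OF cont0[of "w k"] \<eta>] by (simp add: w0)
    qed
    then obtain \<delta>' where \<delta>': "\<delta>' > 0"
      "\<And>x y. norm x < \<delta>' \<Longrightarrow> norm y < \<delta>' \<Longrightarrow> \<forall>k\<in>{..<d}. norm (O2_eval (w k) (x, y)) < \<eta>"
      unfolding eventually_nhds_origin_iff by blast
    \<comment> \<open>Nonzero, so that no (x, y0) is the origin and \<open>A\<close>,
      \<open>B\<close> have no common zero on this slice of the bidisc.\<close>
    define y0 :: complex where "y0 = of_real (min \<delta> \<delta>' / 2)"
    have y0: "y0 \<noteq> 0" "norm y0 < \<delta>" "norm y0 < \<delta>'"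
      using \<delta> \<delta>'(1) by (auto simp: y0_def)
    define c where "c = (\<lambda>k. O2_eval (w k) (0, y0))"
    have c: "norm (c k) \<le> \<eta>" if "k < d" for k
      using \<delta>'(2)[of 0 y0] \<delta>'(1) y0 that by (auto simp: c_def intro: less_imp_le)
    define N where "N = mat d d (\<lambda>(i, k). O2_eval (M i k) (0, y0))"
    \<comment> \<open>Transposed because row i of \<open>M\<close> expands x^i B: a combination of
      the x^i needs a left kernel vector.\<close>
    have N: "transpose_mat N \<in> carrier_mat d d" by (simp add: N_def)
    have "det (transpose_mat N) = 0"
      using E[of 0 y0] \<delta> y0(2) by (subst det_transpose[of _ d]) (simp_all add: N_def)
    then obtain v where v: "v \<in> carrier_vec d" "v \<noteq> 0\<^sub>v d" "transpose_mat N *\<^sub>v v = 0\<^sub>v d"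
      using det_0_iff_vec_prod_zero[OF N] by blast
    have ker: "(\<Sum>i<d. v $ i * O2_eval (M i k) (0, y0)) = 0" if k: "k < d" for k
    proof -
      have "(transpose_mat N *\<^sub>v v) $ k = (\<Sum>i<d. v $ i * O2_eval (M i k) (0, y0))"
        using k v(1) by (auto simp: N_def scalar_prod_def atLeast0LessThan mult.commute intro!: sum.cong)
      thus ?thesis using k unfolding v(3) by simp
    qed
    define u :: "complex poly" where "u = (\<Sum>i<d. Polynomial.monom (v $ i) i)"
    define p :: "complex poly" where "p = Polynomial.monom 1 d - (\<Sum>k<d. Polynomial.monom (c k) k)"
    have coeff_u: "Polynomial.coeff u i = (if i < d then v $ i else 0)" for i
      by (auto simp: u_def Polynomial.coeff_sum)
    have coeff_p: "Polynomial.coeff p d = 1"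
      by (simp add: p_def Polynomial.coeff_sum)
    have poly_p: "poly p x = x ^ d - (\<Sum>k<d. c k * x ^ k)" for x
      by (simp add: p_def poly_sum poly_monom)
    have poly_u: "poly u x = (\<Sum>i<d. v $ i * x ^ i)" for x
      by (simp add: u_def poly_sum poly_monom)
    obtain i0 where i0: "i0 < d" "v $ i0 \<noteq> 0" using v(1,2) by (metis carrier_vecD eq_vecI index_zero_vec)
    hence "u \<noteq> 0" using coeff_u[of i0] by auto
    have "p dvd u"
    proof (rule poly_dvd_of_local_identity[where \<delta> = \<delta>
        and H = "\<lambda>x. O2_eval B (x, y0) * O2_eval Q (x, y0)"
        and S = "\<lambda>x. \<Sum>i<d. v $ i * O2_eval (S i) (x, y0)"])
      show "p \<noteq> 0" using coeff_p by auto
    next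
      fix x assume x: "poly p x = 0"
      have xd: "x ^ d = (\<Sum>k<d. c k * x ^ k)" using x by (simp add: poly_p)
      have xn: "norm x < \<delta>"
        by (rule root_bound[OF \<delta> xd]) (use c in \<open>simp add: \<eta>_def\<close>)
      have "x ^ d = O2_eval Q (x, y0) * O2_eval A (x, y0) + (\<Sum>k<d. c k * x ^ k)"
        using E[OF xn y0(2)] O2_eval_y_only[OF yw, of _ x y0] by (simp add: c_def)
      hence "O2_eval A (x, y0) = 0" using xd E[OF xn y0(2)] by simp
      thus "norm x < \<delta> \<and> O2_eval B (x, y0) * O2_eval Q (x, y0) \<noteq> 0"
        using xn E[OF xn y0(2)] y0(1) by auto
    next
      fix x :: complex assume x: "norm x < \<delta>"
      have "isCont (\<lambda>x. O2_eval F (x, y0)) x" if "isCont (O2_eval F) (x, y0)" for F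
        using isCont_o2[where f = "\<lambda>x. (x, y0)" and g = "O2_eval F" and a = x] that
        by (simp add: continuous_intros)
      thus "isCont (\<lambda>x. \<Sum>i<d. v $ i * O2_eval (S i) (x, y0)) x
          \<and> isCont (\<lambda>x. O2_eval B (x, y0) * O2_eval Q (x, y0)) x"
        using E[OF x y0(2)] by (auto intro!: continuous_intros)
    next
      fix x :: complex assume x: "norm x < \<delta>"
      have Ax: "\<forall>i\<in>{..<d}. x ^ i * O2_eval B (x, y0)
          = O2_eval (S i) (x, y0) * O2_eval A (x, y0) + (\<Sum>k<d. x ^ k * O2_eval (M i k) (0, y0))"
        using E[OF x y0(2)] O2_eval_y_only[OF yM, of _ _ x y0] by simp
      have "poly u x * O2_eval B (x, y0) = (\<Sum>i<d. v $ i * (x ^ i * O2_eval B (x, y0)))"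
        by (simp add: poly_u sum_distrib_right mult.assoc)
      also have "\<dots> = (\<Sum>i<d. v $ i * (O2_eval (S i) (x, y0) * O2_eval A (x, y0)
          + (\<Sum>k<d. x ^ k * O2_eval (M i k) (0, y0))))"
        using Ax by (intro sum.cong) auto
      also have "\<dots> = (\<Sum>i<d. v $ i * O2_eval (S i) (x, y0)) * O2_eval A (x, y0)
          + (\<Sum>i<d. \<Sum>k<d. x ^ k * (v $ i * O2_eval (M i k) (0, y0)))"
        by (simp add: distrib_left sum.distrib sum_distrib_left sum_distrib_right mult_ac)
      also have "(\<Sum>i<d. \<Sum>k<d. x ^ k * (v $ i * O2_eval (M i k) (0, y0)))
          = (\<Sum>k<d. x ^ k * (\<Sum>i<d. v $ i * O2_eval (M i k) (0, y0)))"
        unfolding sum_distrib_left by (rule sum.swap)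
      also have "\<dots> = 0" by (simp add: ker)
      finally have uB: "poly u x * O2_eval B (x, y0)
        = (\<Sum>i<d. v $ i * O2_eval (S i) (x, y0)) * O2_eval A (x, y0)" by simp
      have "poly p x = O2_eval Q (x, y0) * O2_eval A (x, y0)"
        using E[OF x y0(2)] O2_eval_y_only[OF yw, of _ x y0] by (simp add: poly_p c_def)
      thus "poly p x * (\<Sum>i<d. v $ i * O2_eval (S i) (x, y0))
          = poly u x * (O2_eval B (x, y0) * O2_eval Q (x, y0))"
        unfolding mult.assoc[symmetric] uB by (simp only: mult_ac)
    qed
    hence "Polynomial.degree p \<le> Polynomial.degree u" using \<open>u \<noteq> 0\<close> by (rule dvd_imp_degree_le)
    moreover have "d \<le> Polynomial.degree p" using coeff_p by (intro le_degree) simp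
    moreover have "Polynomial.degree u < d"
      using \<open>u \<noteq> 0\<close> coeff_u[of "Polynomial.degree u"] by (metis leading_coeff_0_iff)
    ultimately show ?thesis by simp
  qed
qed

text \<open>If both series vanished on the axis y = 0, common zeros would accumulate at the origin.
  So one of the two can serve as divisor in Weierstrass division, without a change of
  coordinates.\<close>

lemma isolated_singularity_mprimary:
  assumes "isolated_singularity (A, B)"
  shows "mprimary {A, B}"
proof -
  have iso: "\<forall>\<^sub>F z in at (0, 0). \<not> (O2_eval A z = 0 \<and> O2_eval B z = 0)"
    using assms by (simp add: isolated_singularity_def singular_at_def)
  have "fps_nth (fps_of_O2 A) 0 \<noteq> 0 \<or> fps_nth (fps_of_O2 B) 0 \<noteq> 0"
  proof (rule ccontr)
    assume *: "\<not> ?thesis"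
    have "O2_eval F (x, 0) = 0" if "fps_nth (fps_of_O2 F) 0 = 0" for F x
    proof -
      have "O2_coeff F i j * x ^ i * 0 ^ j = 0" for i j
        using that by (cases "j = 0") (auto simp: O2_coeff_def)
      thus ?thesis unfolding O2_eval_def prod.case by (simp only: case_prod_unfold infsum_0)
    qed
    hence zero: "O2_eval A (x, 0) = 0 \<and> O2_eval B (x, 0) = 0" for x using * by simp
    from iso obtain \<delta> where "\<delta> > 0"
      "\<And>x y. norm x < \<delta> \<Longrightarrow> norm y < \<delta> \<Longrightarrow> (x, y) \<noteq> (0, 0) \<longrightarrow> \<not> (O2_eval A (x, y) = 0 \<and> O2_eval B (x, y) = 0)"
      unfolding eventually_at_filter eventually_nhds_origin_iff by blast
    from this(2)[of "of_real (\<delta> / 2)" 0] this(1) zero show False by auto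
  qed
  thus ?thesis
  proof
    assume "fps_nth (fps_of_O2 A) 0 \<noteq> 0"
    thus ?thesis by (rule isolated_common_zero_mprimary_aux[OF iso])
  next
    assume "fps_nth (fps_of_O2 B) 0 \<noteq> 0"
    with iso have "mprimary {B, A}"
      by (intro isolated_common_zero_mprimary_aux) (simp_all add: conj_commute)
    thus ?thesis by (simp add: insert_commute)
  qed
qed

text \<open>Rescaling the coordinates scales the member by a constant. This separates
  \<open>hs\<close> from \<open>\<phi>s\<close>: a bifurcation point and a generic point differ in
  Milnor number.\<close>

lemma milnor_same_point:
  assumes "same_point p q" "p \<noteq> (0, 0)" "q \<noteq> (0, 0)"
  shows "milnor (pencil_member f g p) = milnor (pencil_member f g q)"
proof -
  have *: "idl {O2_dx (pencil_member f g q), O2_dy (pencil_member f g q)}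
      \<subseteq> idl {O2_dx (pencil_member f g p), O2_dy (pencil_member f g p)}"
    if pq: "same_point p q" "p \<noteq> (0, 0)" for p q
  proof -
    obtain c where c: "fst q = c * fst p" "snd q = c * snd p"
    proof (cases "fst p = 0")
      case True
      thus ?thesis using pq that[of "snd q / snd p"] by (cases p) (auto simp: same_point_def)
    next
      case False
      thus ?thesis using pq that[of "fst q / fst p"]
        by (auto simp: same_point_def field_simps)
    qed
    have "pencil_member f g q = O2_const c * pencil_member f g p"
      by (simp add: pencil_member_def c O2_const_simps algebra_simps)
    hence "O2_dx (pencil_member f g q) = O2_const c * O2_dx (pencil_member f g p)"
      "O2_dy (pencil_member f g q) = O2_const c * O2_dy (pencil_member f g p)"
      by (simp_all add: O2_dx_mult O2_dy_mult O2_dx_simps O2_dy_simps)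
    thus ?thesis by (intro idl_le_idlI) (simp add: idl_mult idl_inc)
  qed
  have "same_point q p" using assms(1) same_point_sym by blast
  from *[OF assms(1,2)] *[OF this assms(3)] show ?thesis
    unfolding milnor_def by (intro O2_quotient_dim_cong) blast
qed

text \<open>All pairs of distinct members meet with the same number, so factor j accounts for j
  copies of it. The sum of the j stays unevaluated since it is the same for \<open>hs\<close> and
  \<open>\<phi>s\<close>.\<close>

lemma Theta_pencil:
  assumes "mprimary {f, g}" "sorted_wrt (\<lambda>p q. \<not> same_point p q) ps"
  shows "Theta (map (pencil_member f g) ps) = int (tjurina (pencil_prod f g ps))
     - (\<Sum>j<length ps. int (tjurina (pencil_member f g (ps ! j))))
     - (\<Sum>j<length ps. int j) * int (intersection_number f g)"
proof -
  have "(\<Sum>i<j. int (intersection_number (map (pencil_member f g) ps ! i) (map (pencil_member f g) ps ! j)))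
      = int j * int (intersection_number f g)" if "j < length ps" for j
  proof -
    have "intersection_number (map (pencil_member f g) ps ! i) (map (pencil_member f g) ps ! j)
        = intersection_number f g" if "i < j" for i
      using sorted_wrt_nth_less[OF assms(2) that \<open>j < length ps\<close>] that \<open>j < length ps\<close>
        pencil_members(2)[OF assms(1)] by simp
    thus ?thesis by simp
  qed
  thus ?thesis
    by (simp add: Theta_def pencil_prod_def sum_distrib_right)
qed

theorem proposition4p5:
  fixes f g B0 Binf :: O2 and hs \<phi>s :: "O2 list" and r :: nat
  assumes "coprime f g"
    and "O2_eval f (0, 0) = 0" and "O2_eval g (0, 0) = 0"
    and "isolated_singularity (omega_quotient f g)"
    and "primitive_balanced f g hs \<phi>s"
    and "r = length hs"
    and "B0 = f * g * prod_list hs" and "Binf = prod_list \<phi>s"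
  shows "tjurina_divisor (omega_quotient f g) B0 Binf =
           int (tjurina (f * g))
           + (\<Sum>j<r. int (tjurina (hs ! j)) - int (tjurina_gen f g))
           + int (r ^ 2 * intersection_number f g)
           + Theta [f * g, prod_list hs] + Theta hs - Theta \<phi>s"
proof -
  let ?P = "pencil_prod f g" and ?m = "pencil_member f g"
  let ?ns = "\<lambda>p q. \<not> same_point p q"
  define I where "I = int (intersection_number f g)"
  obtain ps qs where hs: "hs = map ?m ps" and \<phi>s: "\<phi>s = map ?m qs"
    and len: "length ps = length qs" and dist: "sorted_wrt ?ns ps" "sorted_wrt ?ns qs"
    and ps: "\<And>p. p \<in> set ps \<Longrightarrow> bifurcation_point f g p \<and> off_axes p"
    and qs: "\<And>q. q \<in> set qs \<Longrightarrow> generic_point f g q \<and> off_axes q"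
    using assms(5) unfolding primitive_balanced_def by blast
  have r: "length ps = r" "length qs = r" using assms(6) hs len by simp_all

  have \<omega>: "mprimary {fst (omega_quotient f g), snd (omega_quotient f g)}"
    by (rule isolated_singularity_mprimary) (use assms(4) in simp)
  have fg: "mprimary {f, g}"
    by (rule mprimary_mono[OF \<omega>], rule idl_le_idlI)
       (simp add: omega_quotient_def idl_diff idl_mult_right idl_inc)

  let ?ps0 = "[(1, 0), (0, 1)] :: (complex \<times> complex) list" and ?ps2 = "(1, 0) # (0, 1) # ps"
  have m: "?m (1, 0) = f" "?m (0, 1) = g" by (simp_all add: pencil_member_def O2_const_simps)
  have B0: "B0 = ?P ?ps2" using assms(7) by (simp add: m hs pencil_prod_def mult.assoc)
  have Binf: "Binf = ?P qs" using assms(8) by (simp add: \<phi>s pencil_prod_def)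
  have axes: "?ns (1, 0) p \<and> ?ns (0, 1) p" if "off_axes p" for p
    using that unfolding off_axes_def by (simp add: same_point_sym)
  have dist2: "sorted_wrt ?ns ?ps2"
    using dist(1) ps axes by (auto simp: same_point_def)
  have nz: "(0, 0) \<notin> set ?ps2" "(0, 0) \<notin> set qs"
    using ps qs unfolding bifurcation_point_def generic_point_def by auto
  have pq: "?ns p q" if "p \<in> set ps" "q \<in> set qs" for p q
    using ps[OF that(1)] qs[OF that(2)] milnor_same_point[of p q f g]
    unfolding bifurcation_point_def generic_point_def by auto

  have qp: "?ns q p" if "q \<in> set qs" "p \<in> set ?ps2" for p q
    using that pq[of p q] axes[of q] qs[of q] unfolding same_point_sym[of q p] by auto
  have ps2: "?ns p q" if "p \<in> set ps" "q \<in> set ?ps0" for p q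
    using that axes[of p] ps[of p] unfolding same_point_sym[of p q] by auto

  \<comment> \<open>Here n = r + 2, so n (2 - n) = -(r + 2) r.\<close>
  have F: "int (tjurina_foliation (omega_quotient f g) B0) = int (tjurina B0) - (int r + 2) * int r * I"
    using tjurina_foliation_pencil_prod[OF fg \<omega> dist2 nz(1)]
    unfolding B0 I_def by (simp add: r algebra_simps)
  have F': "int (tjurina_foliation (omega_quotient f g) Binf)
      = int (tjurina Binf) + int r * (2 - int r) * I"
    using tjurina_foliation_pencil_prod[OF fg \<omega> dist(2) nz(2)]
    unfolding Binf I_def by (simp add: r)
  have "intersection_number (?P ?ps2) (?P qs) = length qs * length ?ps2 * intersection_number f g"
    by (rule conjunct2[OF pencil_prod_pencil_prod[OF fg]]) (use qp in blast)
  hence I1: "int (intersection_number B0 Binf) = int r * (int r + 2) * I"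
    unfolding B0 Binf I_def by (simp add: r algebra_simps)
  have "intersection_number (?P ?ps0) (?P ps) = length ps * length ?ps0 * intersection_number f g"
    by (rule conjunct2[OF pencil_prod_pencil_prod[OF fg]]) (use ps2 in blast)
  hence I2: "int (intersection_number (f * g) (?P ps)) = 2 * int r * I"
    unfolding I_def by (simp add: m r)
  have \<Theta>0: "Theta [f * g, prod_list hs] = int (tjurina B0) - int (tjurina (f * g)) - int (tjurina (?P ps))
      - 2 * int r * I"
    using I2 by (simp add: Theta_def lessThan_Suc assms(7) hs pencil_prod_def)
  have \<Theta>1: "Theta hs = int (tjurina (?P ps)) - (\<Sum>j<r. int (tjurina (hs ! j))) - (\<Sum>j<r. int j) * I"
    using Theta_pencil[OF fg dist(1)] unfolding hs I_def by (simp add: r)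
  have "tjurina (?m (qs ! j)) = tjurina_gen f g" if "j < r" for j
    using qs[of "qs ! j"] that r unfolding generic_point_def by simp
  hence \<Theta>2: "Theta \<phi>s = int (tjurina Binf) - int r * int (tjurina_gen f g) - (\<Sum>j<r. int j) * I"
    using Theta_pencil[OF fg dist(2)] unfolding \<phi>s Binf I_def by (simp add: r)
  have "int (r ^ 2 * intersection_number f g) = int r * int r * I"
    unfolding I_def by (simp add: power2_eq_square)
  \<comment> \<open>Multiples of \<open>I\<close>: on the left -(r + 2) r - r (2 - r) + r (r + 2) =
    r^2 - 2 r; on the right r^2, lowered by 2 r through the \<open>Theta\<close> of
    \<open>f * g\<close> and the product of \<open>hs\<close>.\<close>
  thus ?thesis
    unfolding tjurina_divisor_def F F' I1 \<Theta>0 \<Theta>1 \<Theta>2 by (simp add: sum_subtractf algebra_simps)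
qed

end
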